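(* Let $n\ge 1$ be any integer and let $\{\mathcal{G}_N\}$ be any family of graphs, $\mathcal{G}_N$ having $N$ vertices, such that each $\mathcal{G}_N$ contains a connected spanning tree. For each $N$ let $L_1,\dots,L_n\in\mathbb{R}^{N\times N}$ be weighted graph Laplacians whose underlying graph is $\mathcal{G}_N$, and let $U_{\mathrm{ref}}\in\mathcal{R}\mathcal{H}_\infty$. Then the controller $$U(s)=U_{\mathrm{ref}}(s)+\left(s^nI-\prod_{k=1}^n(sI+L_k)\right)X(s)$$ for the $n$th order integrator system $\frac{\mathrm{d}^nx_i(t)}{\mathrm{d}t^n}=u_i(t)$, $i=1,\dots,N$, is scalably stable over the family $\{\mathcal{G}_N\}$.
   Context: A weighted directed graph on the vertex set $\mathcal{V}=\{1,\dots,N\}$ with edge set $\mathcal{E}$ is described by a nonnegative adjacency matrix $W$ with $w_{i,j}>0$ if and only if $(j,i)\in\mathcal{E}$; its weighted graph Laplacian $L$ has entries $[L]_{i,j}=-w_{i,j}$ for $i\neq j$ and $[L]_{i,i}=\sum_{k\ne i}w_{i,k}$. The graph contains a connected spanning tree if there is a vertex $i$ from which there is a (directed) path to every other vertex $j$. $\mathcal{R}\mathcal{H}_\infty$ denotes the space of proper, real rational, stable transfer matrices. $X,U$ are the Laplace transforms of $x=(x_1,\dots,x_N)^T$ and $u=(u_1,\dots,u_N)^T$; the closed loop is $\left(\prod_{k=1}^n(sI+L_k)\right)X(s)=U_{\mathrm{ref}}(s)$. Matrix products $\prod_{k=1}^n$ are ordered, with the factor $k=1$ leftmost. The system achieves ($n$th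 order) consensus if $\lim_{t\to\infty}|x_i^{(k)}(t)-x_j^{(k)}(t)|=0$ for all $i,j\in\mathcal{V}$ and all $k\in\{0,1,\dots,n-1\}$, where $x_i^{(k)}$ is the $k$th time derivative. A consensus control design is scalably stable over a family $\{\mathcal{G}_N\}$ if the resulting closed-loop system achieves consensus over any graph in the family. *)

theory Defs
  imports
    "HOL-Analysis.Analysis"
    "Jordan_Normal_Form.Matrix"
    "Graph_Theory.Pair_Digraph"
begin

unbundle no vec_syntax

section \<open>Graphs and weighted graph Laplacians\<close>

text \<open>
  The vertices of a graph on N vertices are 0, ..., N - 1 (instead of 1, ..., N), so that they
  coincide with the row and column indices of the matrices.
\<close>

definition graph_on :: "nat \<Rightarrow> nat pair_pre_digraph \<Rightarrow> bool" where
  "graph_on N G \<longleftrightarrow> pair_wf_digraph G \<and> pverts G = {0..<N}"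

definition contains_connected_spanning_tree :: "nat pair_pre_digraph \<Rightarrow> bool" where
  "contains_connected_spanning_tree G \<longleftrightarrow>
     (\<exists>i\<in>pverts G. \<forall>j\<in>pverts G. j \<noteq> i \<longrightarrow> reachable (with_proj G) i j)"

text \<open>
  The weight in row i and column j belongs to the edge from j to i. Loops are not excluded, but
  the diagonal of the adjacency matrix does not enter the Laplacian.
\<close>

definition adjacency_matrix :: "nat \<Rightarrow> nat pair_pre_digraph \<Rightarrow> real mat \<Rightarrow> bool" where
  "adjacency_matrix N G W \<longleftrightarrow> W \<in> carrier_mat N N \<and>
     (\<forall>i<N. \<forall>j<N. W $$ (i, j) \<ge> 0 \<and> (W $$ (i, j) > 0 \<longleftrightarrow> (j, i) \<in> parcs G))"

definition laplacian_of :: "nat \<Rightarrow> real mat \<Rightarrow> real mat" where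
  "laplacian_of N W = mat N N (\<lambda>(i, j).
     if i = j then (\<Sum>k\<in>{0..<N} - {i}. W $$ (i, k)) else - W $$ (i, j))"

definition weighted_laplacian :: "nat \<Rightarrow> nat pair_pre_digraph \<Rightarrow> real mat \<Rightarrow> bool" where
  "weighted_laplacian N G L \<longleftrightarrow> (\<exists>W. adjacency_matrix N G W \<and> L = laplacian_of N W)"

section \<open>Proper, real rational, stable transfer functions\<close>

text \<open>
  A stable transfer function is identified with its restriction to the closed right half plane;
  nothing is required of the representing function to the left of the imaginary axis, where its
  poles lie.
\<close>

definition RH_inf :: "(complex \<Rightarrow> complex) set" where
  "RH_inf = {H. \<exists>p q :: real poly. degree p \<le> degree q \<and>
     (\<forall>s. Re s \<ge> 0 \<longrightarrow> poly (map_poly complex_of_real q) s \<noteq> 0 \<and>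
        H s = poly (map_poly complex_of_real p) s / poly (map_poly complex_of_real q) s)}"

definition RH_inf_vec :: "nat \<Rightarrow> (complex \<Rightarrow> complex Matrix.vec) set" where
  "RH_inf_vec N = {H. (\<forall>s. H s \<in> carrier_vec N) \<and> (\<forall>i<N. (\<lambda>s. H s $ i) \<in> RH_inf)}"

section \<open>Closed loops and consensus\<close>

definition laplace_converges :: "(real \<Rightarrow> real) \<Rightarrow> complex \<Rightarrow> bool" where
  "laplace_converges f s \<longleftrightarrow>
     set_integrable lborel {0..} (\<lambda>t. exp (- s * complex_of_real t) * complex_of_real (f t))"

definition laplace :: "(real \<Rightarrow> real) \<Rightarrow> complex \<Rightarrow> complex" where
  "laplace f s =
     (LINT t:{0..}|lborel. exp (- s * complex_of_real t) * complex_of_real (f t))"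

definition laplace_vec :: "nat \<Rightarrow> (nat \<Rightarrow> real \<Rightarrow> real) \<Rightarrow> complex \<Rightarrow> complex Matrix.vec" where
  "laplace_vec N x s = Matrix.vec N (\<lambda>i. laplace (x i) s)"

text \<open>A controller maps the complex frequency s and the value X(s) to U(s).\<close>

type_synonym controller = "complex \<Rightarrow> complex Matrix.vec \<Rightarrow> complex Matrix.vec"

text \<open>
  The equation relating X(s) and U(s) is the Laplace transform of the n-th order integrator
  system, where \<open>x0 k i\<close> is the initial value of the k-th derivative of the i-th state:
  s^n X(s) - (s^(n-1) x0 0 + ... + x0 (n-1)) = U(s). It is a transfer function equation, so
  \<open>x0\<close> is the state just before time 0: U(s) need not be strictly proper, and the corresponding
  impulses at time 0 may make the right limits of the derivatives at 0 differ from \<open>x0\<close>.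
  For zero initial state the equation is s^n X(s) = U(s).
\<close>

definition integrator_system ::
  "nat \<Rightarrow> nat \<Rightarrow> (nat \<Rightarrow> nat \<Rightarrow> real) \<Rightarrow> complex \<Rightarrow> complex Matrix.vec \<Rightarrow> complex Matrix.vec \<Rightarrow> bool"
where
  "integrator_system n N x0 s X U \<longleftrightarrow>
     s ^ n \<cdot>\<^sub>v X - Matrix.vec N (\<lambda>i. \<Sum>k<n. s ^ (n - 1 - k) * complex_of_real (x0 k i)) = U"

definition closed_loop_trajectory ::
  "nat \<Rightarrow> nat \<Rightarrow> controller \<Rightarrow> (nat \<Rightarrow> nat \<Rightarrow> real) \<Rightarrow> (nat \<Rightarrow> real \<Rightarrow> real) \<Rightarrow> bool"
where
  "closed_loop_trajectory n N C x0 x \<longleftrightarrow>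
     (\<forall>i<N. \<forall>k<n. \<forall>t>0. (deriv ^^ k) (x i) field_differentiable at t) \<and>
     (\<exists>\<sigma>. \<forall>s. Re s > \<sigma> \<longrightarrow>
        (\<forall>i<N. laplace_converges (x i) s) \<and>
        integrator_system n N x0 s (laplace_vec N x s) (C s (laplace_vec N x s)))"

definition achieves_consensus :: "nat \<Rightarrow> nat pair_pre_digraph \<Rightarrow> controller \<Rightarrow> bool" where
  "achieves_consensus n G C \<longleftrightarrow>
     (\<forall>x0 x. closed_loop_trajectory n (card (pverts G)) C x0 x \<longrightarrow>
        (\<forall>i\<in>pverts G. \<forall>j\<in>pverts G. \<forall>k\<in>{0..<n}.
           ((\<lambda>t. \<bar>(deriv ^^ k) (x i) t - (deriv ^^ k) (x j) t\<bar>) \<longlongrightarrow> 0) at_top))"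

text \<open>
  A family of graphs is given by a set \<open>\<N>\<close> of sizes and, for each N in \<open>\<N>\<close>, a graph on N
  vertices. A control design assigns to each member of the family the controller that is used
  over it.
\<close>

definition scalably_stable ::
  "nat \<Rightarrow> nat set \<Rightarrow> (nat \<Rightarrow> nat pair_pre_digraph) \<Rightarrow> (nat \<Rightarrow> controller) \<Rightarrow> bool"
where
  "scalably_stable n \<N> \<G> C \<longleftrightarrow> (\<forall>N\<in>\<N>. achieves_consensus n (\<G> N) (C N))"

section \<open>The serial consensus controller\<close>

text \<open>The product of the matrices s I + L k for k = 1, ..., n, with the factor k = 1 leftmost.\<close>

definition serial_product :: "nat \<Rightarrow> nat \<Rightarrow> (nat \<Rightarrow> real mat) \<Rightarrow> complex \<Rightarrow> complex mat" where
  "serial_product n N L s =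
     foldr (\<lambda>k M. (s \<cdot>\<^sub>m 1\<^sub>m N + map_mat complex_of_real (L k)) * M) [1..<Suc n] (1\<^sub>m N)"

definition serial_controller ::
  "nat \<Rightarrow> nat \<Rightarrow> (nat \<Rightarrow> real mat) \<Rightarrow> (complex \<Rightarrow> complex Matrix.vec) \<Rightarrow> controller"
where
  "serial_controller n N L Uref s X =
     Uref s + (s ^ n \<cdot>\<^sub>m 1\<^sub>m N - serial_product n N L s) *\<^sub>v X"

end

theory Submission
  imports Defs "HOL-Probability.Levy" "Jordan_Normal_Form.Schur_Decomposition"
begin

text \<open>
  In the closed loop \<open>(s I + L 1) \<dots> (s I + L n) X(s) = U(s) + I(s)\<close>, where \<open>I(s)\<close> collects the
  initial values, every Laplacian has the eigenvalue 0, so \<open>X\<close> may have poles at 0 of order up to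
  \<open>n\<close> and need not be bounded. But the eigenvectors of the eigenvalue 0 are the same for all
  factors, namely the constant vectors, and consensus concerns only differences of components.
  Modulo the constants, a Laplacian of a graph with a spanning tree has all its eigenvalues in the
  open right half plane: nonzero eigenvalues by Gershgorin's theorem
  (\<open>laplacian_eigenvalue_Re_pos\<close>), and the eigenvalue 0 disappears because extrema of a vector
  with constant image spread along the edges to the root (\<open>laplacian_preimage_of_constant\<close>).

  The differences \<open>x i - x 0\<close> therefore satisfy a closed loop of the same serial form with
  matrices whose resolvents are strictly proper and stable
  (\<open>difference_laplacian_eigenvalue\<close>). Each of the \<open>n\<close> resolvents
  lowers the degree of the polynomial part of the right-hand side by one
  (\<open>laplacian_step_differences\<close>). This right-hand side is the sum of a proper stable function and
  of polynomials of degree less than \<open>n\<close>, so the transforms of the differences are strictly proper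
  and stable. Such a transform is a finite sum of terms \<open>c / (s - \<nu>) ^ (m + 1)\<close> with
  \<open>Re \<nu> < 0\<close>; by uniqueness of the Laplace transform (\<open>laplace_unique\<close>) the difference
  is for positive times the real part of a finite sum of terms \<open>c t ^ m exp (\<nu> t)\<close>, which tends to 0
  together with all its derivatives.
\<close>

unbundle no vec_syntax

section \<open>Stable modes and their Laplace transforms\<close>

text \<open>
  Pairing each time function with its transform lets Laplace transforms be inverted by
  constructing a derivation, and lets statements about either side be proved by one induction.
\<close>

inductive stable_mode_sum :: "(real \<Rightarrow> complex) \<Rightarrow> (complex \<Rightarrow> complex) \<Rightarrow> bool" where
  mode: "Re \<nu> < 0 \<Longrightarrow> stable_mode_sum (\<lambda>t. of_real t ^ m / fact m * exp (\<nu> * of_real t)) (\<lambda>s. 1 / (s - \<nu>) ^ Suc m)"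
| add: "stable_mode_sum g G \<Longrightarrow> stable_mode_sum h H \<Longrightarrow> stable_mode_sum (\<lambda>t. g t + h t) (\<lambda>s. G s + H s)"
| scale: "stable_mode_sum g G \<Longrightarrow> stable_mode_sum (\<lambda>t. c * g t) (\<lambda>s. c * G s)"

text \<open>
  Up to a constant, the modulus of a mode on the half-line is an Erlang density.
\<close>

lemma mode_integrable:
  assumes "Re a > 0"
  shows "set_integrable lborel {0..} (\<lambda>t. of_real t ^ m / fact m * exp (- a * complex_of_real t))"
proof -
  let ?d = "erlang_density m (Re a)"
  have "integrable lborel ?d"
    using nn_integral_erlang_ith_moment[OF assms, of m 0]
    by (intro integrableI_nonneg) (use assms in auto)
  then have "integrable lborel (\<lambda>t. ?d t / Re a ^ Suc m)" by simp
  then show ?thesis unfolding set_integrable_def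
  proof (rule Bochner_Integration.integrable_bound)
    show "AE x in lborel. norm (indicator {0..} x *\<^sub>R (complex_of_real x ^ m / fact m * exp (- a * complex_of_real x)))
      \<le> norm (?d x / Re a ^ Suc m)"
      using assms
      by (intro AE_I2) (auto simp: erlang_density_def norm_mult norm_divide norm_power indicator_def)
  qed measurable
qed

text \<open>
  The point 0 lies inside the domain of differentiability, so the open half-line on which the
  interval version of the fundamental theorem works can be closed up at a null set.
\<close>

lemma integral_atLeast_FTC:
  fixes F f :: "real \<Rightarrow> complex"
  assumes "\<And>t. (F has_vector_derivative f t) (at t)" "\<And>t. isCont f t"
    and "set_integrable lborel {0..} f" "(F \<longlongrightarrow> 0) at_top"
  shows "(LINT t:{0..}|lborel. f t) = - F 0"
proof -
  have i: "set_integrable lborel {0<..} f"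
    using assms(3) by (rule set_integrable_subset) auto
  have "(LBINT t=0..\<infinity>. f t) = 0 - F 0"
  proof (rule interval_integral_FTC_integrable)
    show "set_integrable lborel (einterval 0 \<infinity>) f"
      using i by (simp add: zero_ereal_def)
    have "isCont F 0" using assms(1)[of 0] by (rule has_vector_derivative_continuous)
    then show "((F \<circ> real_of_ereal) \<longlongrightarrow> F 0) (at_right 0)"
      unfolding zero_ereal_def ereal_tendsto_simps isCont_def
      by (rule tendsto_within_subset) simp
    show "((F \<circ> real_of_ereal) \<longlongrightarrow> 0) (at_left \<infinity>)"
      unfolding ereal_tendsto_simps by (rule assms)
  qed (use assms in auto)
  moreover have "(LBINT t=0..\<infinity>. f t) = (LINT t:{0<..}|lborel. f t)"
    by (simp add: interval_lebesgue_integral_def zero_ereal_def)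
  moreover have "(LINT t:{0<..}|lborel. f t) = (LINT t:{0..}|lborel. f t)"
    unfolding set_lebesgue_integral_def
    apply (rule integral_cong_AE)
    subgoal using i by (simp add: set_integrable_def)
    subgoal using assms(3) by (simp add: set_integrable_def)
    using AE_lborel_singleton[of 0]
    by (eventually_elim) (auto simp: indicator_def)
  ultimately show ?thesis by simp
qed

lemma mode_tendsto_0:
  assumes "Re a > 0"
  shows "((\<lambda>t. of_real t ^ m / fact m * exp (- a * complex_of_real t)) \<longlongrightarrow> 0) at_top"
proof (rule Lim_null_comparison)
  show "\<forall>\<^sub>F t in at_top. norm (of_real t ^ m / fact m * exp (- a * complex_of_real t)) \<le> t ^ m / fact m * exp (- Re a * t)"
    using eventually_ge_at_top[of 0]
    by eventually_elim (simp add: norm_mult norm_divide norm_power)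
  have "((\<lambda>t. (Re a * t) ^ m / exp (Re a * t)) \<longlongrightarrow> 0) at_top"
    by (rule filterlim_compose[OF tendsto_power_div_exp_0])
       (intro filterlim_tendsto_pos_mult_at_top[OF tendsto_const assms] filterlim_ident)
  from tendsto_mult[OF tendsto_const[of "1 / (fact m * Re a ^ m)"] this]
  show "((\<lambda>t. t ^ m / fact m * exp (- Re a * t)) \<longlongrightarrow> 0) at_top"
    using assms by (simp add: field_simps exp_minus)
qed

text \<open>
  The case distinction is needed because the truncated exponent \<open>m - 1\<close> would make a
  nonzero term out of the derivative of a constant.
\<close>

lemma mode_has_derivative:
  "((\<lambda>t. of_real t ^ m / fact m * exp (\<nu> * complex_of_real t)) has_vector_derivative
     (if m = 0 then 0 else of_real t ^ (m - 1) / fact (m - 1) * exp (\<nu> * of_real t))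
       + \<nu> * (of_real t ^ m / fact m * exp (\<nu> * of_real t))) (at t)"
proof -
  have p: "((\<lambda>z. z ^ m / fact m) has_field_derivative (if m = 0 then 0 else z ^ (m - 1) / fact (m - 1))) (at z)"
    for z :: complex
  proof (cases m)
    case (Suc k)
    have "((\<lambda>z. z ^ Suc k / fact (Suc k)) has_field_derivative z ^ k / fact k) (at z)"
    proof (rule DERIV_cong[OF DERIV_cdivide])
      show "((\<lambda>z. z ^ Suc k) has_field_derivative of_nat (Suc k) * z ^ k) (at z)"
        using DERIV_power[OF DERIV_ident, of "Suc k" z UNIV] by (simp add: mult.commute)
      show "of_nat (Suc k) * z ^ k / fact (Suc k) = z ^ k / fact k"
        unfolding fact_Suc by (simp del: of_nat_Suc)
    qed
    then show ?thesis using Suc by simp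
  qed simp
  have "((\<lambda>z. z ^ m / fact m * exp (\<nu> * z)) has_field_derivative
     (if m = 0 then 0 else z ^ (m - 1) / fact (m - 1) * exp (\<nu> * z))
       + \<nu> * (z ^ m / fact m * exp (\<nu> * z))) (at z)" for z
  proof (rule DERIV_cong[OF DERIV_mult[OF p]])
    show "((\<lambda>z. exp (\<nu> * z)) has_field_derivative exp (\<nu> * z) * \<nu>) (at z)"
      by (rule DERIV_fun_exp) (simp add: DERIV_cmult_Id)
  qed (simp add: algebra_simps)
  from has_vector_derivative_real_field[OF this] show ?thesis .
qed

text \<open>
  Integrating the derivative of the mode with exponent \<open>m + 1\<close> over the half-line gives
  \<open>0 = I m - a * I (m + 1)\<close>, a recursion for the integrals \<open>I m\<close>.
\<close>

lemma mode_integral: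
  assumes "Re a > 0"
  shows "(LINT t:{0..}|lborel. of_real t ^ m / fact m * exp (- a * complex_of_real t)) = 1 / a ^ Suc m"
proof (induction m)
  have a0: "a \<noteq> 0" using assms by auto
  let ?e = "\<lambda>m t. of_real t ^ m / fact m * exp (- a * complex_of_real t)"
  note i = mode_integrable[OF assms]
  have i': "set_integrable lborel {0..} (\<lambda>t. - a * ?e m t)" for m
    by (rule set_integrable_mult_right) (rule i)
  have c: "isCont (?e m) t" for m t
    by (intro continuous_intros) auto
  have c': "isCont (\<lambda>t. - a * ?e m t) t" for m t
    by (rule continuous_mult[OF continuous_const c])
  {
    case 0
    have "(LINT t:{0..}|lborel. - a * ?e 0 t) = - ?e 0 0"
      using mode_has_derivative[of 0 "-a"] mode_tendsto_0[OF assms, of 0]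
      by (intro integral_atLeast_FTC[OF _ c' i']) simp_all
    then have "- a * (LINT t:{0..}|lborel. ?e 0 t) = - 1"
      unfolding set_integral_mult_right by simp
    then show ?case using a0 by (simp add: field_simps)
  next
    case (Suc m)
    have d: "(?e (Suc m) has_vector_derivative (?e m t + - a * ?e (Suc m) t)) (at t)" for t
      using mode_has_derivative[of "Suc m" "-a" t] by (simp only: nat.distinct if_False diff_Suc_1)
    have "(LINT t:{0..}|lborel. ?e m t + - a * ?e (Suc m) t) = - ?e (Suc m) 0"
      by (rule integral_atLeast_FTC[OF d continuous_add[OF c c'] set_integral_add(1)[OF i i'] mode_tendsto_0[OF assms]])
    moreover have "(LINT t:{0..}|lborel. ?e m t + - a * ?e (Suc m) t)
       = (LINT t:{0..}|lborel. ?e m t) + - a * (LINT t:{0..}|lborel. ?e (Suc m) t)"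
      unfolding set_integral_add(2)[OF i i'] set_integral_mult_right ..
    moreover have "?e (Suc m) 0 = 0" by simp
    ultimately have "1 / a ^ Suc m = a * (LINT t:{0..}|lborel. ?e (Suc m) t)"
      using Suc by simp
    then show ?case using a0 by (simp add: field_simps)
  }
qed

lemma stable_mode_sum_laplace:
  assumes "stable_mode_sum g G" "Re s \<ge> 0"
  shows "set_integrable lborel {0..} (\<lambda>t. exp (- s * complex_of_real t) * g t)
    \<and> (LINT t:{0..}|lborel. exp (- s * complex_of_real t) * g t) = G s"
  using assms
proof (induction rule: stable_mode_sum.induct)
  case (mode \<nu> m)
  have e: "exp (- s * of_real t) * (of_real t ^ m / fact m * exp (\<nu> * of_real t))
     = of_real t ^ m / fact m * exp (- (s - \<nu>) * complex_of_real t)" for t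
    by (simp add: algebra_simps flip: exp_add)
  from mode have "Re (s - \<nu>) > 0" by simp
  from mode_integrable[OF this, of m] mode_integral[OF this, of m]
  show ?case unfolding e by simp
next
  case (add g G h H)
  then show ?case by (simp add: distrib_left set_integral_add)
next
  case (scale g G c)
  have e: "exp (- s * of_real t) * (c * g t) = c * (exp (- s * of_real t) * g t)" for t by simp
  from scale show ?case unfolding e by (simp add: set_integrable_mult_right)
qed

lemma stable_mode_sum_tendsto_0: "stable_mode_sum g G \<Longrightarrow> (g \<longlongrightarrow> 0) at_top"
proof (induction rule: stable_mode_sum.induct)
  case (mode \<nu> m)
  then show ?case using mode_tendsto_0[of "-\<nu>" m] by simp
next
  case (add g G h H)
  then show ?case by (intro tendsto_add_zero)
next
  case (scale g G c)
  then show ?case by (intro tendsto_mult_right_zero)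
qed

lemma stable_mode_sum_0: "stable_mode_sum (\<lambda>_. 0) (\<lambda>_. 0)"
  using stable_mode_sum.scale[OF stable_mode_sum.mode[of "-1" 0], of 0] by simp

lemma stable_mode_sum_derivative:
  "stable_mode_sum g G \<Longrightarrow> \<exists>g' G'. stable_mode_sum g' G' \<and> (\<forall>t. (g has_vector_derivative g' t) (at t))"
proof (induction rule: stable_mode_sum.induct)
  case (mode \<nu> m)
  let ?e = "\<lambda>m t. of_real t ^ m / fact m * exp (\<nu> * complex_of_real t)"
  note 1 = stable_mode_sum.scale[OF stable_mode_sum.mode[OF mode, of m], of \<nu>]
  have "\<exists>G'. stable_mode_sum (\<lambda>t. (if m = 0 then 0 else ?e (m - 1) t) + \<nu> * ?e m t) G'"
  proof (cases "m = 0")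
    case True
    show ?thesis using stable_mode_sum.add[OF stable_mode_sum_0 1] by (simp only: True refl if_True) (rule exI)
  next
    case False
    show ?thesis using stable_mode_sum.add[OF stable_mode_sum.mode[OF mode, of "m - 1"] 1]
      by (simp only: False if_False) (rule exI)
  qed
  then obtain G' where "stable_mode_sum (\<lambda>t. (if m = 0 then 0 else ?e (m - 1) t) + \<nu> * ?e m t) G'" ..
  moreover have "\<forall>t. (?e m has_vector_derivative (if m = 0 then 0 else ?e (m - 1) t) + \<nu> * ?e m t) (at t)"
    by (intro allI mode_has_derivative)
  ultimately show ?case by (intro exI conjI)
next
  case (add g G h H)
  then obtain g' G' h' H' where *: "stable_mode_sum g' G'" "stable_mode_sum h' H'"
    and "\<forall>t. (g has_vector_derivative g' t) (at t)" "\<forall>t. (h has_vector_derivative h' t) (at t)" by blast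
  then have "\<forall>t. ((\<lambda>t. g t + h t) has_vector_derivative (g' t + h' t)) (at t)"
    by (simp add: has_vector_derivative_add)
  with stable_mode_sum.add[OF *] show ?case by (intro exI conjI)
next
  case (scale g G c)
  then obtain g' G' where *: "stable_mode_sum g' G'" and "\<forall>t. (g has_vector_derivative g' t) (at t)" by blast
  then have "\<forall>t. ((\<lambda>t. c * g t) has_vector_derivative (c * g' t)) (at t)"
    by (simp add: has_vector_derivative_mult_right)
  with stable_mode_sum.scale[OF *(1), of c] show ?case by (intro exI conjI)
qed

section \<open>Stable strictly proper transfer functions\<close>

text \<open>
  Values in the open left half plane, where the poles lie, are ignored.
\<close>

definition stable_transfer :: "(complex \<Rightarrow> complex) \<Rightarrow> bool" where
  "stable_transfer H \<longleftrightarrow> (\<exists>g K. stable_mode_sum g K \<and> (\<forall>s. Re s \<ge> 0 \<longrightarrow> H s = K s))"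

lemma stable_transferI: "stable_mode_sum g K \<Longrightarrow> stable_transfer K"
  unfolding stable_transfer_def by blast

lemma stable_transfer_cong:
  "stable_transfer K \<Longrightarrow> (\<And>s. Re s \<ge> 0 \<Longrightarrow> H s = K s) \<Longrightarrow> stable_transfer H"
  unfolding stable_transfer_def by metis

lemma stable_transfer_0: "stable_transfer (\<lambda>_. 0)"
  by (rule stable_transferI[OF stable_mode_sum_0])

lemma stable_transfer_mode: "Re \<nu> < 0 \<Longrightarrow> stable_transfer (\<lambda>s. 1 / (s - \<nu>) ^ Suc m)"
  by (rule stable_transferI[OF stable_mode_sum.mode])

lemma stable_transfer_add:
  assumes "stable_transfer G" "stable_transfer H"
  shows "stable_transfer (\<lambda>s. G s + H s)"
proof -
  obtain g G' h H' where "stable_mode_sum g G'" "stable_mode_sum h H'"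
    and e: "\<forall>s. Re s \<ge> 0 \<longrightarrow> G s = G' s" "\<forall>s. Re s \<ge> 0 \<longrightarrow> H s = H' s"
    using assms unfolding stable_transfer_def by blast
  then have "stable_transfer (\<lambda>s. G' s + H' s)"
    by (intro stable_transferI[OF stable_mode_sum.add])
  then show ?thesis by (rule stable_transfer_cong) (simp add: e)
qed

lemma stable_transfer_scale:
  assumes "stable_transfer G"
  shows "stable_transfer (\<lambda>s. c * G s)"
proof -
  obtain g G' where "stable_mode_sum g G'" and e: "\<forall>s. Re s \<ge> 0 \<longrightarrow> G s = G' s"
    using assms unfolding stable_transfer_def by blast
  then have "stable_transfer (\<lambda>s. c * G' s)"
    by (intro stable_transferI[OF stable_mode_sum.scale])
  then show ?thesis by (rule stable_transfer_cong) (simp add: e)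
qed

text \<open>
  This replaces a partial fraction decomposition: for distinct poles,
  \<open>1 / ((s - \<nu>) (s - \<mu>)) = (1 / (s - \<nu>) - 1 / (s - \<mu>)) / (\<nu> - \<mu>)\<close>, and the
  multiplicity of \<open>\<nu>\<close> goes down by induction.
\<close>

lemma stable_transfer_mode_divide_linear:
  assumes "Re \<nu> < 0" "Re \<mu> < 0"
  shows "stable_transfer (\<lambda>s. 1 / (s - \<nu>) ^ Suc m / (s - \<mu>))"
proof (cases "\<nu> = \<mu>")
  case True
  show ?thesis
    by (rule stable_transfer_cong[OF stable_transfer_mode[OF assms(1), of "Suc m"]])
       (simp add: True mult.commute)
next
  case False
  have nz: "s - \<nu> \<noteq> 0" "s - \<mu> \<noteq> 0" "\<nu> - \<mu> \<noteq> 0" if "Re s \<ge> 0" for s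
    using False assms that by auto
  show ?thesis
  proof (induction m)
    case 0
    show ?case
    proof (rule stable_transfer_cong[OF stable_transfer_add[OF
          stable_transfer_scale[OF stable_transfer_mode[OF assms(1), of 0], of "1 / (\<nu> - \<mu>)"]
          stable_transfer_scale[OF stable_transfer_mode[OF assms(2), of 0], of "- 1 / (\<nu> - \<mu>)"]]])
      fix s :: complex assume "Re s \<ge> 0"
      from nz[OF this] show "1 / (s - \<nu>) ^ Suc 0 / (s - \<mu>) =
         1 / (\<nu> - \<mu>) * (1 / (s - \<nu>) ^ Suc 0) + - 1 / (\<nu> - \<mu>) * (1 / (s - \<mu>) ^ Suc 0)"
        by (simp add: divide_simps)
    qed
  next
    case (Suc m)
    show ?case
    proof (rule stable_transfer_cong[OF stable_transfer_add[OF
          stable_transfer_scale[OF stable_transfer_mode[OF assms(1), of "Suc m"], of "1 / (\<nu> - \<mu>)"]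
          stable_transfer_scale[OF Suc, of "- 1 / (\<nu> - \<mu>)"]]])
      fix s :: complex assume "Re s \<ge> 0"
      from nz[OF this] show "1 / (s - \<nu>) ^ Suc (Suc m) / (s - \<mu>) =
         1 / (\<nu> - \<mu>) * (1 / (s - \<nu>) ^ Suc (Suc m)) + - 1 / (\<nu> - \<mu>) * (1 / (s - \<nu>) ^ Suc m / (s - \<mu>))"
        by (simp add: divide_simps)
    qed
  qed
qed

lemma stable_transfer_divide_linear:
  assumes "stable_transfer H" and \<mu>: "Re \<mu> < 0"
  shows "stable_transfer (\<lambda>s. H s / (s - \<mu>))"
proof -
  obtain k K where "stable_mode_sum k K" and e: "\<forall>s. Re s \<ge> 0 \<longrightarrow> H s = K s"
    using assms unfolding stable_transfer_def by blast
  from this(1) have "stable_transfer (\<lambda>s. K s / (s - \<mu>))"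
  proof (induction rule: stable_mode_sum.induct)
    case (mode \<nu> m)
    then show ?case by (rule stable_transfer_mode_divide_linear[OF _ \<mu>])
  next
    case (add g G h H)
    from stable_transfer_add[OF add(3,4)] show ?case by (simp add: add_divide_distrib)
  next
    case (scale g G c)
    from stable_transfer_scale[OF scale(2), of c] show ?case by simp
  qed
  then show ?thesis by (rule stable_transfer_cong) (simp add: e)
qed

section \<open>Uniqueness and inversion of the Laplace transform\<close>

text \<open>
  Positive and negative part of \<open>h\<close> have the same Fourier transform. Normalised by their
  common mass they are densities of probability measures with the same characteristic function,
  and Levy's uniqueness theorem identifies these.
\<close>

lemma AE_zero_if_fourier_zero:
  fixes h :: "real \<Rightarrow> real"
  assumes h: "integrable lborel h"
    and zero: "\<And>\<tau>. (LINT t|lborel. h t *\<^sub>R iexp (\<tau> * t)) = 0"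
  shows "AE t in lborel. h t = 0"
proof -
  define p q where "p t = max 0 (h t)" and "q t = max 0 (- h t)" for t
  have [simp]: "p t \<ge> 0" "q t \<ge> 0" and pq: "h t = p t - q t" for t
    by (auto simp: p_def q_def)
  have ip: "integrable lborel p" and iq: "integrable lborel q"
    unfolding p_def q_def using h by auto
  have [measurable]: "p \<in> borel_measurable borel" "q \<in> borel_measurable borel"
    using borel_measurable_integrable[OF ip] borel_measurable_integrable[OF iq] by simp_all
  have ie: "integrable lborel (\<lambda>t. f t *\<^sub>R iexp (\<tau> * t))" if "integrable lborel f" for f :: "real \<Rightarrow> real" and \<tau>
    using that by (rule Bochner_Integration.integrable_bound)
      (use borel_measurable_integrable[OF that] in \<open>auto intro!: AE_I2\<close>)
  have fourier_eq: "(LINT t|lborel. p t *\<^sub>R iexp (\<tau> * t)) = (LINT t|lborel. q t *\<^sub>R iexp (\<tau> * t))" for \<tau>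
  proof -
    have "(LINT t|lborel. p t *\<^sub>R iexp (\<tau> * t)) - (LINT t|lborel. q t *\<^sub>R iexp (\<tau> * t))
      = (LINT t|lborel. p t *\<^sub>R iexp (\<tau> * t) - q t *\<^sub>R iexp (\<tau> * t))"
      by (rule Bochner_Integration.integral_diff[OF ie[OF ip] ie[OF iq], symmetric])
    also have "\<dots> = (LINT t|lborel. h t *\<^sub>R iexp (\<tau> * t))"
      unfolding pq scaleR_diff_left ..
    finally show ?thesis using zero by simp
  qed
  \<comment> \<open>Frequency 0 shows that both parts have the same mass.\<close>
  define m where "m = (LINT t|lborel. p t)"
  have mq: "m = (LINT t|lborel. q t)"
  proof -
    have "complex_of_real m = of_real (LINT t|lborel. q t)"
      using fourier_eq[of 0] unfolding m_def integral_complex_of_real[symmetric] by (simp add: scaleR_conv_of_real)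
    then show ?thesis by (simp only: of_real_eq_iff)
  qed
  show ?thesis
  proof (cases "m = 0")
    case True
    have "AE t in lborel. p t = 0" "AE t in lborel. q t = 0"
      using True mq integral_nonneg_eq_0_iff_AE[OF ip] integral_nonneg_eq_0_iff_AE[OF iq]
      unfolding m_def by simp_all
    then show ?thesis by eventually_elim (simp add: pq)
  next
    case False
    have "m \<ge> 0" unfolding m_def by (rule Bochner_Integration.integral_nonneg) simp
    with False have m: "m > 0" by simp
    let ?D = "\<lambda>f. density lborel (\<lambda>t. ennreal (f t / m))"
    have dist: "real_distribution (?D f)" and ch: "char (?D f) \<tau> = (LINT t|lborel. f t *\<^sub>R iexp (\<tau> * t)) / m"
      if f: "integrable lborel f" "\<And>t. f t \<ge> 0" "(LINT t|lborel. f t) = m" for f \<tau>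
    proof -
      have [measurable]: "f \<in> borel_measurable borel"
        using borel_measurable_integrable[OF f(1)] by simp
      have "emeasure (?D f) (space (?D f)) = (\<integral>\<^sup>+t. ennreal (f t / m) \<partial>lborel)"
        by (simp add: emeasure_density)
      also have "\<dots> = ennreal (LINT t|lborel. f t / m)"
        by (rule nn_integral_eq_integral) (use f m in auto)
      also have "\<dots> = 1" using f m by simp
      finally show "real_distribution (?D f)"
        by (intro real_distribution.intro prob_spaceI real_distribution_axioms.intro) auto
      have "char (?D f) \<tau> = (LINT t|lborel. (f t / m) *\<^sub>R iexp (\<tau> * t))"
        unfolding char_def by (rule integral_density) (use f m in auto)
      also have "\<dots> = (LINT t|lborel. (f t *\<^sub>R iexp (\<tau> * t)) / m)"
        by (rule Bochner_Integration.integral_cong) (auto simp: scaleR_conv_of_real)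
      also have "\<dots> = (LINT t|lborel. f t *\<^sub>R iexp (\<tau> * t)) / m"
        by (rule integral_divide_zero)
      finally show "char (?D f) \<tau> = (LINT t|lborel. f t *\<^sub>R iexp (\<tau> * t)) / m" .
    qed
    have "char (?D p) = char (?D q)"
      using ch[OF ip] ch[OF iq] fourier_eq mq m_def by (intro ext) simp
    then have "?D p = ?D q"
      by (intro Levy_uniqueness dist) (use ip iq mq m_def in auto)
    then have "AE t in lborel. ennreal (p t / m) = ennreal (q t / m)"
      by (subst (asm) sigma_finite_measure.density_unique_iff[OF lborel.sigma_finite_measure_axioms]) auto
    then show ?thesis by eventually_elim (use m in \<open>simp add: pq\<close>)
  qed
qed

lemma AE_eq_imp_eq_if_isCont:
  fixes f g :: "real \<Rightarrow> real"
  assumes ae: "AE t in lborel. t \<ge> 0 \<longrightarrow> f t = g t"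
    and "t > 0" "isCont f t" "isCont g t"
  shows "f t = g t"
proof (rule ccontr)
  assume "f t \<noteq> g t"
  moreover have "isCont (\<lambda>x. f x - g x) t" by (intro continuous_diff assms)
  ultimately obtain e where e: "e > 0" "\<And>y. dist t y < e \<Longrightarrow> f y - g y \<noteq> 0"
    using continuous_at_avoid[of t "\<lambda>x. f x - g x" 0] by auto
  \<comment> \<open>The neighbourhood is cut off at 0 because nothing is known about negative times.\<close>
  define S where "S = {max 0 (t - e)<..<t + e}"
  have "AE x in lborel. x \<notin> S"
    using ae by eventually_elim (use e in \<open>fastforce simp: S_def dist_real_def\<close>)
  then have "S \<in> null_sets lborel"
    by (subst AE_iff_null_sets) (auto simp: S_def)
  then show False using e(1) \<open>t > 0\<close> by (auto simp: S_def null_sets_def max_def split: if_splits)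
qed

text \<open>
  On a vertical line the transform of \<open>f - g\<close> is the Fourier transform of the integrable
  function that equals \<open>exp (- a t) * (f t - g t)\<close> on the half-line and 0 to its left. Only
  the values at positive times are determined, since \<open>f\<close> may jump at time 0.
\<close>

lemma laplace_unique:
  fixes f g :: "real \<Rightarrow> real"
  assumes conv: "\<And>s. Re s = a \<Longrightarrow> laplace_converges f s" "\<And>s. Re s = a \<Longrightarrow> laplace_converges g s"
    and eq: "\<And>s. Re s = a \<Longrightarrow> laplace f s = laplace g s"
    and t: "t > 0" "isCont f t" "isCont g t"
  shows "f t = g t"
proof -
  define h where "h t = indicator {0..} t * exp (- a * t) * (f t - g t)" for t
  \<comment> \<open>The sign is that of the kernel \<open>iexp (\<tau> * t)\<close> of characteristic functions.\<close>
  let ?s = "\<lambda>\<tau>. Complex a (- \<tau>)"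
  have e: "exp (- Complex a (- \<tau>) * of_real t) = exp (- a * t) *\<^sub>R iexp (\<tau> * t)" for \<tau> t :: real
  proof -
    have "- Complex a (- \<tau>) * of_real t = of_real (- a * t) + \<i> * of_real (\<tau> * t)"
      by (simp add: complex_eq_iff)
    then show ?thesis by (simp only: exp_add scaleR_conv_of_real exp_of_real)
  qed
  have i: "set_integrable lborel {0..} (\<lambda>t. exp (- ?s \<tau> * complex_of_real t) * complex_of_real (f t))"
    "set_integrable lborel {0..} (\<lambda>t. exp (- ?s \<tau> * complex_of_real t) * complex_of_real (g t))" for \<tau>
    using conv[of "?s \<tau>"] by (simp_all add: laplace_converges_def)
  have hi: "h t *\<^sub>R iexp (\<tau> * t) = indicator {0..} t *\<^sub>R
     (exp (- ?s \<tau> * complex_of_real t) * complex_of_real (f t) - exp (- ?s \<tau> * complex_of_real t) * complex_of_real (g t))"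
    for \<tau> t unfolding e h_def by (simp add: scaleR_conv_of_real algebra_simps)
  have "integrable lborel (\<lambda>t. h t *\<^sub>R iexp (0 * t))"
    unfolding hi using set_integral_diff(1)[OF i] by (simp only: set_integrable_def)
  then have "integrable lborel (\<lambda>t. complex_of_real (h t))"
    by (simp add: scaleR_conv_of_real)
  then have "integrable lborel h" by (simp only: complex_of_real_integrable_eq)
  moreover have "(LINT t|lborel. h t *\<^sub>R iexp (\<tau> * t)) = 0" for \<tau>
  proof -
    have "(LINT t|lborel. h t *\<^sub>R iexp (\<tau> * t)) = laplace f (?s \<tau>) - laplace g (?s \<tau>)"
      unfolding hi laplace_def set_integral_diff(2)[OF i, symmetric] by (simp only: set_lebesgue_integral_def)
    then show ?thesis using eq[of "?s \<tau>"] by simp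
  qed
  ultimately have "AE t in lborel. h t = 0" by (rule AE_zero_if_fourier_zero)
  then have "AE t in lborel. t \<ge> 0 \<longrightarrow> f t = g t"
    by eventually_elim (auto simp: h_def indicator_def)
  from AE_eq_imp_eq_if_isCont[OF this t] show ?thesis .
qed

text \<open>
  A real function has a transform symmetric under conjugation, so conjugating a complex
  function with the same transform does not change its transform.
\<close>

lemma laplace_Re:
  fixes f :: "real \<Rightarrow> real"
  assumes f: "\<And>s. Re s = a \<Longrightarrow> laplace f s = K s"
    and g: "\<And>s. Re s = a \<Longrightarrow> set_integrable lborel {0..} (\<lambda>t. exp (- s * complex_of_real t) * g t)"
      "\<And>s. Re s = a \<Longrightarrow> (LINT t:{0..}|lborel. exp (- s * complex_of_real t) * g t) = K s"
    and s: "Re s = a"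
  shows "laplace_converges (\<lambda>t. Re (g t)) s" "laplace (\<lambda>t. Re (g t)) s = K s"
proof -
  let ?e = "\<lambda>s t. exp (- s * complex_of_real t)"
  have cnj: "indicator {0..} t *\<^sub>R (?e s t * cnj (h t)) = cnj (indicator {0..} t *\<^sub>R (?e (cnj s) t * h t))"
    for h s and t :: real by (simp add: exp_cnj)
  have s': "Re (cnj s) = a" using s by simp
  have i: "set_integrable lborel {0..} (\<lambda>t. ?e s t * cnj (g t))"
    using g(1)[OF s'] unfolding set_integrable_def cnj by (rule integrable_cnj)
  have "(LINT t:{0..}|lborel. ?e s t * cnj (g t)) = cnj (LINT t:{0..}|lborel. ?e (cnj s) t * g t)"
    unfolding set_lebesgue_integral_def cnj by (rule Bochner_Integration.integral_cnj)
  also have "\<dots> = cnj (laplace f (cnj s))" using g(2)[OF s'] f[OF s'] by simp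
  also have "\<dots> = laplace f s"
    unfolding laplace_def set_lebesgue_integral_def Bochner_Integration.integral_cnj[symmetric] cnj[symmetric] by (simp add: exp_cnj)
  also have "\<dots> = K s" by (rule f[OF s])
  finally have c: "(LINT t:{0..}|lborel. ?e s t * cnj (g t)) = K s" .
  have e: "?e s t * complex_of_real (Re (g t)) = (1 / 2) * (?e s t * g t + ?e s t * cnj (g t))" for t
    by (simp add: complex_add_cnj flip: distrib_left)
  show "laplace_converges (\<lambda>t. Re (g t)) s"
    unfolding laplace_converges_def e
    by (intro set_integrable_mult_right set_integral_add(1) g(1)[OF s] i)
  show "laplace (\<lambda>t. Re (g t)) s = K s"
    unfolding laplace_def e set_integral_mult_right set_integral_add(2)[OF g(1)[OF s] i] c g(2)[OF s]
    by simp
qed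

lemma laplace_diff:
  assumes "laplace_converges f s" "laplace_converges h s"
  shows "laplace_converges (\<lambda>t. f t - h t) s" "laplace (\<lambda>t. f t - h t) s = laplace f s - laplace h s"
  using set_integral_diff[OF assms[unfolded laplace_converges_def]]
  by (simp_all add: laplace_converges_def laplace_def right_diff_distrib)

text \<open>
  Here transforms are inverted: the stable modes that make up the transform are known, and by
  uniqueness they are the function.
\<close>

lemma eq_stable_modes_if_laplace_stable:
  fixes y :: "real \<Rightarrow> real"
  assumes K: "stable_transfer K" and a: "a \<ge> 0"
    and y: "\<And>s. Re s = a \<Longrightarrow> laplace_converges y s" "\<And>s. Re s = a \<Longrightarrow> laplace y s = K s"
    and cont: "\<And>t. t > 0 \<Longrightarrow> isCont y t"
  shows "\<exists>g G. stable_mode_sum g G \<and> (\<forall>t>0. y t = Re (g t))"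
proof -
  obtain g G where gG: "stable_mode_sum g G" and G: "\<And>s. Re s \<ge> 0 \<Longrightarrow> K s = G s"
    using K unfolding stable_transfer_def by blast
  have g: "set_integrable lborel {0..} (\<lambda>t. exp (- s * complex_of_real t) * g t)"
    "(LINT t:{0..}|lborel. exp (- s * complex_of_real t) * g t) = K s" if "Re s = a" for s
    using stable_mode_sum_laplace[OF gG, of s] that a G by auto
  note Re_g = laplace_Re[OF y(2) g]
  have "y t = Re (g t)" if "t > 0" for t
  proof (rule laplace_unique[of a y "\<lambda>t. Re (g t)"])
    obtain g' where "(g has_vector_derivative g' t) (at t)"
      using stable_mode_sum_derivative[OF gG] by blast
    then show "isCont (\<lambda>t. Re (g t)) t"
      by (intro isCont_Re has_vector_derivative_continuous)
  qed (use y Re_g cont that in auto)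
  with gG show ?thesis by blast
qed

text \<open>
  Sums of stable modes are closed under differentiation, so a description of \<open>f - h\<close> as such
  a sum passes to all derivatives that exist.
\<close>

lemma iterated_derivative_difference:
  fixes f h :: "real \<Rightarrow> real"
  assumes diff: "\<And>k t. k < n \<Longrightarrow> t > 0 \<Longrightarrow> (deriv ^^ k) f field_differentiable at t"
      "\<And>k t. k < n \<Longrightarrow> t > 0 \<Longrightarrow> (deriv ^^ k) h field_differentiable at t"
    and g: "stable_mode_sum g G" "\<And>t. t > 0 \<Longrightarrow> f t - h t = Re (g t)"
  shows "k < n \<Longrightarrow> \<exists>g G. stable_mode_sum g G \<and> (\<forall>t>0. (deriv ^^ k) f t - (deriv ^^ k) h t = Re (g t))"
proof (induction k)
  case 0
  then show ?case using g by auto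
next
  case (Suc k)
  then obtain g G where g: "stable_mode_sum g G"
    and eq: "\<And>t. t > 0 \<Longrightarrow> (deriv ^^ k) f t - (deriv ^^ k) h t = Re (g t)" by auto
  from stable_mode_sum_derivative[OF g] obtain g' G' where g': "stable_mode_sum g' G'"
    and der: "\<And>t. (g has_vector_derivative g' t) (at t)" by blast
  have "(deriv ^^ Suc k) f t - (deriv ^^ Suc k) h t = Re (g' t)" if t: "t > 0" for t
  proof (rule DERIV_unique)
    have "((\<lambda>t. (deriv ^^ k) f t - (deriv ^^ k) h t) has_real_derivative
        deriv ((deriv ^^ k) f) t - deriv ((deriv ^^ k) h) t) (at t)"
      using diff[OF Suc_lessD[OF Suc.prems] t] by (intro DERIV_diff) (simp_all add: field_differentiable_derivI)
    then show "((\<lambda>t. (deriv ^^ k) f t - (deriv ^^ k) h t) has_real_derivative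
        (deriv ^^ Suc k) f t - (deriv ^^ Suc k) h t) (at t)" by simp
    have "((\<lambda>t. Re (g t)) has_real_derivative Re (g' t)) (at t)"
      using bounded_linear.has_vector_derivative[OF bounded_linear_Re der[of t]]
      by (simp add: has_real_derivative_iff_has_vector_derivative)
    then show "((\<lambda>t. (deriv ^^ k) f t - (deriv ^^ k) h t) has_real_derivative Re (g' t)) (at t)"
      by (rule has_field_derivative_transform_within_open[of _ _ _ "{0<..}"]) (use t eq in auto)
  qed
  with g' show ?case by blast
qed

section \<open>Stable transfer functions with a polynomial part\<close>

text \<open>
  The polynomial part has degree less than \<open>d\<close>; for \<open>d = 0\<close> it vanishes and \<open>H\<close> is
  strictly proper. Equality is required only on the half plane \<open>Re s > \<sigma>\<close>, where the transforms
  of a closed loop are known to exist.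
\<close>

definition stable_plus_poly :: "real \<Rightarrow> nat \<Rightarrow> (complex \<Rightarrow> complex) \<Rightarrow> bool" where
  "stable_plus_poly \<sigma> d H \<longleftrightarrow> (\<exists>p K. (\<forall>i\<ge>d. coeff p i = 0) \<and> stable_transfer K \<and>
     (\<forall>s. Re s > \<sigma> \<longrightarrow> H s = poly p s + K s))"

lemma stable_plus_polyI:
  "(\<And>i. i \<ge> d \<Longrightarrow> coeff p i = 0) \<Longrightarrow> stable_transfer K \<Longrightarrow>
    (\<And>s. Re s > \<sigma> \<Longrightarrow> H s = poly p s + K s) \<Longrightarrow> stable_plus_poly \<sigma> d H"
  unfolding stable_plus_poly_def by blast

lemma stable_plus_poly_cong:
  "stable_plus_poly \<sigma> d G \<Longrightarrow> (\<And>s. Re s > \<sigma> \<Longrightarrow> H s = G s) \<Longrightarrow> stable_plus_poly \<sigma> d H"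
  unfolding stable_plus_poly_def by metis

lemma stable_plus_poly_mono:
  "stable_plus_poly \<sigma> d H \<Longrightarrow> d \<le> e \<Longrightarrow> stable_plus_poly \<sigma> e H"
  unfolding stable_plus_poly_def by (meson order_trans)

lemma stable_plus_poly_poly:
  "(\<And>i. i \<ge> d \<Longrightarrow> coeff p i = 0) \<Longrightarrow> stable_plus_poly \<sigma> d (poly p)"
  by (rule stable_plus_polyI[OF _ stable_transfer_0]) auto

lemma stable_plus_poly_0_iff:
  "stable_plus_poly \<sigma> 0 H \<longleftrightarrow> (\<exists>K. stable_transfer K \<and> (\<forall>s. Re s > \<sigma> \<longrightarrow> H s = K s))"
proof -
  have "(\<forall>i\<ge>0. coeff p i = 0) \<longleftrightarrow> p = 0" for p :: "complex poly"
    by (auto simp: poly_eq_iff)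
  then show ?thesis by (simp add: stable_plus_poly_def)
qed

lemma stable_plus_poly_add:
  assumes "stable_plus_poly \<sigma> d G" "stable_plus_poly \<sigma> d H"
  shows "stable_plus_poly \<sigma> d (\<lambda>s. G s + H s)"
proof -
  obtain p K where p: "\<forall>i\<ge>d. coeff p i = 0" and K: "stable_transfer K"
    and G: "\<forall>s. Re s > \<sigma> \<longrightarrow> G s = poly p s + K s"
    using assms(1) unfolding stable_plus_poly_def by blast
  obtain q M where q: "\<forall>i\<ge>d. coeff q i = 0" and M: "stable_transfer M"
    and H: "\<forall>s. Re s > \<sigma> \<longrightarrow> H s = poly q s + M s"
    using assms(2) unfolding stable_plus_poly_def by blast
  show ?thesis
    by (rule stable_plus_polyI[OF _ stable_transfer_add[OF K M], of _ "p + q"])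
       (use p q G H in auto)
qed

lemma stable_plus_poly_scale:
  assumes "stable_plus_poly \<sigma> d G"
  shows "stable_plus_poly \<sigma> d (\<lambda>s. c * G s)"
proof -
  obtain p K where p: "\<forall>i\<ge>d. coeff p i = 0" and K: "stable_transfer K"
    and G: "\<forall>s. Re s > \<sigma> \<longrightarrow> G s = poly p s + K s"
    using assms unfolding stable_plus_poly_def by blast
  show ?thesis
    by (rule stable_plus_polyI[OF _ stable_transfer_scale[OF K, of c], of _ "Polynomial.smult c p"])
       (use p G in \<open>auto simp: algebra_simps\<close>)
qed

lemma stable_plus_poly_diff:
  "stable_plus_poly \<sigma> d G \<Longrightarrow> stable_plus_poly \<sigma> d H \<Longrightarrow> stable_plus_poly \<sigma> d (\<lambda>s. G s - H s)"
  using stable_plus_poly_add[OF _ stable_plus_poly_scale[of \<sigma> d H "- 1"], of G] by simp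

lemma stable_plus_poly_sum:
  assumes "\<And>j. j \<in> J \<Longrightarrow> stable_plus_poly \<sigma> d (H j)"
  shows "stable_plus_poly \<sigma> d (\<lambda>s. \<Sum>j\<in>J. H j s)"
  using assms
proof (induction J rule: infinite_finite_induct)
  case (insert j J)
  then show ?case by (simp add: stable_plus_poly_add)
qed (use stable_plus_poly_poly[of d 0 \<sigma>] in \<open>simp_all add: poly_0[abs_def]\<close>)

text \<open>
  The quotient of the polynomial part loses one degree, and its remainder contributes a simple
  pole at \<open>\<mu>\<close>. Each resolvent in the closed loop uses up one degree in this way.
\<close>

lemma stable_plus_poly_divide_linear:
  assumes H: "stable_plus_poly \<sigma> d H" and \<mu>: "Re \<mu> < 0" and \<sigma>: "\<sigma> \<ge> 0"
  shows "stable_plus_poly \<sigma> (d - 1) (\<lambda>s. H s / (s - \<mu>))"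
proof -
  obtain p K where p: "\<forall>i\<ge>d. coeff p i = 0" and K: "stable_transfer K"
    and H: "\<forall>s. Re s > \<sigma> \<longrightarrow> H s = poly p s + K s"
    using H unfolding stable_plus_poly_def by blast
  let ?q = "synthetic_div p \<mu>"
  have dq: "coeff ?q i = 0" if "i \<ge> d - 1" for i
  proof (cases "degree p = 0")
    case False
    have "degree p < d" by (rule ccontr) (use p False leading_coeff_0_iff[of p] in auto)
    then show ?thesis using that False by (intro coeff_eq_0) (auto simp: degree_synthetic_div)
  qed (simp add: synthetic_div_eq_0_iff[THEN iffD2])
  have st: "stable_transfer (\<lambda>s. poly p \<mu> * (1 / (s - \<mu>) ^ Suc 0) + K s / (s - \<mu>))"
    by (intro stable_transfer_add stable_transfer_scale stable_transfer_mode
        stable_transfer_divide_linear K \<mu>)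
  show ?thesis
  proof (rule stable_plus_polyI[OF _ st])
    show "coeff ?q i = 0" if "i \<ge> d - 1" for i using that by (rule dq)
  next
    fix s :: complex assume s: "Re s > \<sigma>"
    then have "s - \<mu> \<noteq> 0" using \<mu> \<sigma> by auto
    moreover have "poly p s = (s - \<mu>) * poly ?q s + poly p \<mu>"
      by (subst synthetic_div_correct'[of \<mu> p, symmetric]) (simp add: algebra_simps)
    ultimately show "H s / (s - \<mu>) = poly ?q s + (poly p \<mu> * (1 / (s - \<mu>) ^ Suc 0) + K s / (s - \<mu>))"
      using H s by (simp add: add_divide_distrib)
  qed
qed

lemma stable_plus_poly_divide_poly:
  assumes "stable_plus_poly \<sigma> d H" "\<And>s. poly q s = 0 \<Longrightarrow> Re s < 0" "\<sigma> \<ge> 0"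
  shows "stable_plus_poly \<sigma> (d - degree q) (\<lambda>s. H s / poly q s)"
  using assms(1,2)
proof (induction "degree q" arbitrary: q d H)
  case 0
  then obtain c where "q = [:c:]" by (metis degree_eq_zeroE)
  then show ?case using stable_plus_poly_scale[OF 0(2), of "1 / c"] by simp
next
  case (Suc n)
  then obtain \<mu> where \<mu>: "poly q \<mu> = 0"
    by (metis fundamental_theorem_of_algebra constant_degree Zero_neq_Suc)
  then obtain r where q: "q = [:- \<mu>, 1:] * r" by (metis poly_eq_0_iff_dvd dvdE)
  have "r \<noteq> 0" using Suc(2) q by auto
  then have deg: "degree q = Suc (degree r)" unfolding q by (subst degree_mult_eq) auto
  have "stable_plus_poly \<sigma> (d - 1 - degree r) (\<lambda>s. H s / (s - \<mu>) / poly r s)"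
  proof (rule Suc.hyps(1))
    show "n = degree r" using deg Suc(2) by simp
    show "stable_plus_poly \<sigma> (d - 1) (\<lambda>s. H s / (s - \<mu>))"
      by (rule stable_plus_poly_divide_linear[OF Suc(3) Suc(4)[OF \<mu>] assms(3)])
    show "Re s < 0" if "poly r s = 0" for s using Suc(4)[of s] that q by simp
  qed
  moreover have "H s / (s - \<mu>) / poly r s = H s / poly q s" for s
    unfolding q poly_mult by simp
  moreover have "d - 1 - degree r = d - degree q" by (simp add: deg)
  ultimately show ?case by (simp only:)
qed

text \<open>
  The numerator lies in class \<open>degree p + 1\<close>, and division by the denominator lowers the class
  by \<open>degree q \<ge> degree p\<close>: at most a constant is left besides the stable part.
\<close>

lemma RH_inf_stable_plus_poly_1:
  assumes "H \<in> RH_inf" "\<sigma> \<ge> 0"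
  shows "stable_plus_poly \<sigma> 1 H"
proof -
  obtain p q :: "real poly" where deg: "degree p \<le> degree q"
    and q: "\<And>s. Re s \<ge> 0 \<Longrightarrow> poly (map_poly complex_of_real q) s \<noteq> 0"
    and H: "\<And>s. Re s \<ge> 0 \<Longrightarrow> H s = poly (map_poly complex_of_real p) s / poly (map_poly complex_of_real q) s"
    using assms(1) unfolding RH_inf_def by blast
  have "stable_plus_poly \<sigma> (Suc (degree p)) (poly (map_poly complex_of_real p))"
    by (rule stable_plus_poly_poly) (simp add: coeff_map_poly coeff_eq_0)
  then have "stable_plus_poly \<sigma> (Suc (degree p) - degree (map_poly complex_of_real q))
    (\<lambda>s. poly (map_poly complex_of_real p) s / poly (map_poly complex_of_real q) s)"
    by (rule stable_plus_poly_divide_poly) (use q assms(2) in \<open>simp_all, meson not_le\<close>)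
  then have "stable_plus_poly \<sigma> 1
    (\<lambda>s. poly (map_poly complex_of_real p) s / poly (map_poly complex_of_real q) s)"
    by (rule stable_plus_poly_mono) (use deg in \<open>simp add: degree_map_poly\<close>)
  then show ?thesis by (rule stable_plus_poly_cong) (use H assms(2) in simp)
qed

section \<open>Resolvents of stable matrices\<close>

text \<open>
  Back substitution from the last row upwards: \<open>Z i\<close> arises from \<open>W i\<close> and the later
  \<open>Z j\<close> by division by \<open>s + T i i\<close>, which has its root in the open left half plane.
\<close>

lemma resolvent_stable_triangular:
  fixes T :: "nat \<Rightarrow> nat \<Rightarrow> complex"
  assumes upper: "\<And>i j. j < i \<Longrightarrow> i < N \<Longrightarrow> T i j = 0"
    and diag: "\<And>i. i < N \<Longrightarrow> Re (T i i) > 0" and \<sigma>: "\<sigma> \<ge> 0"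
    and eq: "\<And>s i. Re s > \<sigma> \<Longrightarrow> i < N \<Longrightarrow> s * Z i s + (\<Sum>j<N. T i j * Z j s) = W i s"
    and W: "\<And>i. i < N \<Longrightarrow> stable_plus_poly \<sigma> (Suc d) (W i)"
  shows "i < N \<Longrightarrow> stable_plus_poly \<sigma> d (Z i)"
proof (induction "N - i" arbitrary: i rule: less_induct)
  case less
  have "stable_plus_poly \<sigma> (Suc d) (\<lambda>s. W i s - (\<Sum>j\<in>{i<..<N}. T i j * Z j s))"
  proof (intro stable_plus_poly_diff stable_plus_poly_sum stable_plus_poly_scale W less)
    fix j assume j: "j \<in> {i<..<N}"
    show "stable_plus_poly \<sigma> (Suc d) (Z j)"
      by (rule stable_plus_poly_mono[OF less(1)]) (use j less in auto)
  qed
  from stable_plus_poly_divide_linear[OF this _ \<sigma>, of "- T i i"] diag[OF less(2)]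
  have "stable_plus_poly \<sigma> d (\<lambda>s. (W i s - (\<Sum>j\<in>{i<..<N}. T i j * Z j s)) / (s + T i i))"
    by simp
  then show ?case
  proof (rule stable_plus_poly_cong)
    fix s :: complex assume s: "Re s > \<sigma>"
    have "s + T i i \<noteq> 0" using s \<sigma> diag[OF less(2)]
      by (metis add_pos_pos le_less_trans less_irrefl plus_complex.sel(1) zero_complex.sel(1))
    moreover have "(\<Sum>j<N. T i j * Z j s) = T i i * Z i s + (\<Sum>j\<in>{i<..<N}. T i j * Z j s)"
    proof -
      have "(\<Sum>j<N. T i j * Z j s) = (\<Sum>j\<in>{i..<N}. T i j * Z j s)"
        by (rule sum.mono_neutral_right) (use upper less(2) in auto)
      also have "{i..<N} = insert i {i<..<N}" using less(2) by auto
      finally show ?thesis by simp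
    qed
    ultimately show "Z i s = (W i s - (\<Sum>j\<in>{i<..<N}. T i j * Z j s)) / (s + T i i)"
      using eq[OF s less(2)] by (simp add: field_simps)
  qed
qed

text \<open>
  A Schur decomposition reduces this to the triangular case, because a constant change of basis
  preserves the classes of transfer functions.
\<close>

lemma resolvent_stable:
  fixes A :: "complex mat"
  assumes A: "A \<in> carrier_mat N N"
    and ev: "\<And>\<mu>. eigenvalue A \<mu> \<Longrightarrow> Re \<mu> > 0" and \<sigma>: "\<sigma> \<ge> 0"
    and eq: "\<And>s i. Re s > \<sigma> \<Longrightarrow> i < N \<Longrightarrow> s * Z i s + (\<Sum>j<N. A $$ (i,j) * Z j s) = W i s"
    and W: "\<And>i. i < N \<Longrightarrow> stable_plus_poly \<sigma> (Suc d) (W i)"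
    and i: "i < N"
  shows "stable_plus_poly \<sigma> d (Z i)"
proof -
  from char_poly_factorized[OF A] obtain es where es: "char_poly A = (\<Prod>a\<leftarrow>es. [:- a, 1:])" by blast
  from schur_decomposition_exists[OF A es] obtain B where
    B: "B \<in> carrier_mat N N" and ut: "upper_triangular B" and sim: "similar_mat A B" by blast
  from sim obtain P Q where wit: "similar_mat_wit A B P Q" unfolding similar_mat_def by blast
  note PQ = similar_mat_witD2[OF A wit]
  \<comment> \<open>The diagonal of a triangular form consists of eigenvalues of the matrix.\<close>
  have diag: "Re (B $$ (i,i)) > 0" if "i < N" for i
  proof (rule ev)
    have "B $$ (i,i) \<in> set (diag_mat B)" using B that by (auto simp: diag_mat_def)
    then have "poly (char_poly B) (B $$ (i,i)) = 0"
      unfolding char_poly_upper_triangular[OF B ut] by (auto simp: poly_prod_list prod_list_zero_iff)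
    then show "eigenvalue A (B $$ (i,i))"
      unfolding eigenvalue_root_char_poly[OF A] char_poly_similar[OF sim] .
  qed
  have QA: "Q * A = B * Q"
  proof -
    have "Q * A = Q * (P * (B * Q))" using PQ by (simp add: assoc_mult_mat[of _ N N _ N _ N])
    also have "\<dots> = (Q * P) * (B * Q)" using PQ by (intro assoc_mult_mat[symmetric]) auto
    finally show ?thesis using PQ by simp
  qed
  define z where "z s = Matrix.vec N (\<lambda>j. Z j s)" for s
  define w where "w s = Matrix.vec N (\<lambda>j. W j s)" for s
  have [simp]: "z s \<in> carrier_vec N" "w s \<in> carrier_vec N" for s by (auto simp: z_def w_def)
  have mv: "(M *\<^sub>v v) $ i = (\<Sum>j<N. M $$ (i,j) * v $ j)"
    if "M \<in> carrier_mat N N" "v \<in> carrier_vec N" "i < N" for M v and i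
    using that by (auto simp: scalar_prod_def lessThan_atLeast0 intro!: sum.cong)
  have eqv: "s \<cdot>\<^sub>v z s + A *\<^sub>v z s = w s" if "Re s > \<sigma>" for s
  proof (rule eq_vecI)
    fix i assume "i < dim_vec (w s)"
    then have "i < N" by (simp add: w_def)
    then show "(s \<cdot>\<^sub>v z s + A *\<^sub>v z s) $ i = w s $ i"
      using eq[OF that] A mv[OF A _ \<open>i < N\<close>, of "z s"] by (simp add: w_def z_def)
  qed (use A in \<open>auto simp: w_def\<close>)
  have eqv': "s \<cdot>\<^sub>v (Q *\<^sub>v z s) + B *\<^sub>v (Q *\<^sub>v z s) = Q *\<^sub>v w s" if "Re s > \<sigma>" for s
  proof -
    have "Q *\<^sub>v w s = Q *\<^sub>v (s \<cdot>\<^sub>v z s) + Q *\<^sub>v (A *\<^sub>v z s)"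
      unfolding eqv[OF that, symmetric]
      by (rule mult_add_distrib_mat_vec[OF PQ(7)]) (use A in \<open>auto intro!: mult_mat_vec_carrier\<close>)
    also have "Q *\<^sub>v (A *\<^sub>v z s) = B *\<^sub>v (Q *\<^sub>v z s)"
      unfolding assoc_mult_mat_vec[OF PQ(7) A \<open>z s \<in> _\<close>, symmetric] QA
      by (rule assoc_mult_mat_vec[OF B PQ(7)]) simp
    also have "Q *\<^sub>v (s \<cdot>\<^sub>v z s) = s \<cdot>\<^sub>v (Q *\<^sub>v z s)"
      using PQ by (intro mult_mat_vec) auto
    finally show ?thesis ..
  qed
  have Z': "stable_plus_poly \<sigma> d (\<lambda>s. (Q *\<^sub>v z s) $ i)" if "i < N" for i
  proof (rule resolvent_stable_triangular[where T = "\<lambda>i j. B $$ (i,j)" and W = "\<lambda>i s. (Q *\<^sub>v w s) $ i"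
        and Z = "\<lambda>i s. (Q *\<^sub>v z s) $ i", OF _ diag \<sigma> _ _ that])
    show "B $$ (i, j) = 0" if "j < i" "i < N" for i j
      using upper_triangularD[OF ut that(1)] that(2) B by simp
    show "s * (Q *\<^sub>v z s) $ i + (\<Sum>j<N. B $$ (i, j) * (Q *\<^sub>v z s) $ j) = (Q *\<^sub>v w s) $ i"
      if "Re s > \<sigma>" "i < N" for s i
    proof -
      have c: "Q *\<^sub>v z s \<in> carrier_vec N" using PQ by (intro mult_mat_vec_carrier) auto
      show ?thesis using arg_cong[OF eqv'[OF that(1)], of "\<lambda>v. v $ i"] c B PQ(7) that(2)
          mv[OF B c that(2)] by simp
    qed
    show "stable_plus_poly \<sigma> (Suc d) (\<lambda>s. (Q *\<^sub>v w s) $ i)" if "i < N" for i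
      unfolding mv[OF PQ(7) \<open>w _ \<in> _\<close> that]
      by (intro stable_plus_poly_sum stable_plus_poly_scale) (use W in \<open>simp add: w_def\<close>)
  qed
  have "stable_plus_poly \<sigma> d (\<lambda>s. \<Sum>j<N. P $$ (i,j) * (Q *\<^sub>v z s) $ j)"
    by (intro stable_plus_poly_sum stable_plus_poly_scale Z') simp
  moreover have "Z i s = (\<Sum>j<N. P $$ (i,j) * (Q *\<^sub>v z s) $ j)" for s
  proof -
    have "Z i s = z s $ i" using i by (simp add: z_def)
    also have "z s = P *\<^sub>v (Q *\<^sub>v z s)"
      unfolding assoc_mult_mat_vec[OF PQ(6,7) \<open>z s \<in> _\<close>, symmetric] PQ(1) by simp
    also have "\<dots> $ i = (\<Sum>j<N. P $$ (i,j) * (Q *\<^sub>v z s) $ j)"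
      using PQ i by (intro mv mult_mat_vec_carrier[of _ N N]) auto
    finally show ?thesis .
  qed
  ultimately show ?thesis by (rule stable_plus_poly_cong)
qed

section \<open>The spectrum of a Laplacian modulo the constants\<close>

lemma ex_maximizer_lessThan:
  fixes f :: "nat \<Rightarrow> real"
  assumes "0 < N"
  shows "\<exists>m<N. \<forall>k<N. f k \<le> f m"
proof -
  have "Max (f ` {..<N}) \<in> f ` {..<N}" using assms by (intro Max_in) auto
  then obtain m where "m < N" "Max (f ` {..<N}) = f m" by auto
  moreover have "f k \<le> Max (f ` {..<N})" if "k < N" for k using that by (intro Max_ge) auto
  ultimately show ?thesis by auto
qed

text \<open>
  Gershgorin's argument in the row where \<open>v\<close> has its largest modulus: \<open>\<mu>\<close> lies in the disc
  with centre and radius \<open>S\<close>, the sum of the weights in that row. This disc meets the closed left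
  half plane only at 0.
\<close>

lemma laplacian_eigenvalue_Re_pos:
  fixes v :: "nat \<Rightarrow> complex" and w :: "nat \<Rightarrow> nat \<Rightarrow> real"
  assumes w: "\<And>i j. i < N \<Longrightarrow> j < N \<Longrightarrow> w i j \<ge> 0"
    and eq: "\<And>i. i < N \<Longrightarrow> (\<Sum>k\<in>{0..<N} - {i}. w i k * (v i - v k)) = \<mu> * v i"
    and "\<mu> \<noteq> 0" and nz: "\<exists>i<N. v i \<noteq> 0"
  shows "Re \<mu> > 0"
proof (rule ccontr)
  assume neg: "\<not> Re \<mu> > 0"
  obtain i where i: "i < N" "\<And>k. k < N \<Longrightarrow> cmod (v k) \<le> cmod (v i)"
    using ex_maximizer_lessThan[of N "\<lambda>i. cmod (v i)"] nz by auto
  have vi: "v i \<noteq> 0" using nz i(2) by force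
  define S where "S = (\<Sum>k\<in>{0..<N} - {i}. w i k)"
  have S: "S \<ge> 0" unfolding S_def by (rule sum_nonneg) (use w i in auto)
  have "(S - \<mu>) * v i = (\<Sum>k\<in>{0..<N} - {i}. w i k * v k)"
    using eq[OF i(1)] by (simp add: S_def algebra_simps sum_subtractf sum_distrib_left)
  also have "cmod \<dots> \<le> (\<Sum>k\<in>{0..<N} - {i}. w i k * cmod (v i))"
    by (rule sum_norm_le) (use w i in \<open>auto simp: norm_mult intro!: mult_left_mono\<close>)
  also have "\<dots> = S * cmod (v i)" by (simp add: S_def sum_distrib_right)
  finally have "cmod (S - \<mu>) \<le> S" using vi by (simp add: norm_mult)
  then have "(cmod (S - \<mu>))\<^sup>2 \<le> S\<^sup>2" by (rule power_mono) simp
  then have "(S - Re \<mu>)\<^sup>2 + (Im \<mu>)\<^sup>2 \<le> S\<^sup>2" by (simp add: cmod_power2)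
  moreover have "S\<^sup>2 \<le> (S - Re \<mu>)\<^sup>2" using S neg by (intro power_mono) auto
  ultimately have "(Im \<mu>)\<^sup>2 \<le> 0" by linarith
  then have im: "Im \<mu> = 0" by simp
  then have "(S - Re \<mu>)\<^sup>2 \<le> S\<^sup>2" using \<open>(S - Re \<mu>)\<^sup>2 + (Im \<mu>)\<^sup>2 \<le> S\<^sup>2\<close> by simp
  then have "\<bar>S - Re \<mu>\<bar> \<le> \<bar>S\<bar>" by (simp only: abs_le_square_iff)
  then have "Re \<mu> = 0" using S neg by simp
  with im \<open>\<mu> \<noteq> 0\<close> show False by (simp add: complex_eq_iff)
qed

text \<open>
  At a maximum \<open>y\<close> all summands \<open>W $$ (y, k) * (u y - u k)\<close> are nonnegative; if their sum is
  not positive, every in-neighbour of \<open>y\<close> is a maximum too. Walking backwards along a path leads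
  to the root.
\<close>

lemma maximum_attained_at_root:
  assumes G: "graph_on N G" and reach: "reachable (with_proj G) r j"
    and W: "adjacency_matrix N G W"
    and eq: "\<And>i. i < N \<Longrightarrow> (\<Sum>k\<in>{0..<N} - {i}. W $$ (i,k) * (u i - u k)) = (c::real)"
    and c: "c \<le> 0" and max: "\<And>k. k < N \<Longrightarrow> u k \<le> u j"
  shows "u r = u j"
proof -
  interpret pair_wf_digraph G using G by (simp add: graph_on_def)
  have verts: "pverts G = {0..<N}" using G by (simp add: graph_on_def)
  from reach show ?thesis using max
  proof (induction rule: reachable_induct)
    case (step x y)
    then have "(x, y) \<in> parcs G" by simp
    then have xy: "x < N" "y < N" using wellformed[of "(x,y)"] verts by auto
    have pos: "W $$ (y,x) > 0" and nn: "\<And>k. k < N \<Longrightarrow> W $$ (y,k) \<ge> 0"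
      using W xy \<open>(x, y) \<in> parcs G\<close> by (auto simp: adjacency_matrix_def)
    have "u x = u y"
    proof (cases "x = y")
      case False
      have nonneg: "W $$ (y,k) * (u y - u k) \<ge> 0" if "k < N" for k
        using nn[OF that] step.prems[OF that] by simp
      have "W $$ (y,x) * (u y - u x) \<le> (\<Sum>k\<in>{0..<N} - {y}. W $$ (y,k) * (u y - u k))"
        by (rule member_le_sum) (use False xy nonneg in auto)
      then have "W $$ (y,x) * (u y - u x) \<le> 0" using eq[OF xy(2)] c by simp
      then have "u y - u x \<le> 0" using pos by (simp add: mult_le_0_iff)
      then show ?thesis using step.prems[OF xy(1)] by simp
    qed simp
    moreover have "u r = u x" by (rule step.IH) (use step.prems calculation in simp)
    ultimately show ?case by simp
  qed simp
qed

text \<open>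
  Looking at a maximum and at a minimum of \<open>u\<close> shows \<open>c = 0\<close>. Then both extrema are attained
  at the root of the spanning tree. In other words, 0 is an eigenvalue of the Laplacian without
  Jordan chains, and its eigenvectors are constant.
\<close>

lemma laplacian_preimage_of_constant:
  fixes u :: "nat \<Rightarrow> real"
  assumes G: "graph_on N G" "contains_connected_spanning_tree G"
    and W: "adjacency_matrix N G W"
    and eq: "\<And>i. i < N \<Longrightarrow> (\<Sum>k\<in>{0..<N} - {i}. W $$ (i,k) * (u i - u k)) = c"
    and ij: "i < N" "j < N"
  shows "u i = u j"
proof -
  interpret pair_wf_digraph G using G by (simp add: graph_on_def)
  have verts: "pverts G = {0..<N}" using G by (simp add: graph_on_def)
  obtain r where r: "r < N" "\<And>j. j < N \<Longrightarrow> reachable (with_proj G) r j"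
    using G(2) verts unfolding contains_connected_spanning_tree_def
    by (metis atLeastLessThan_iff reachable_refl with_proj_simps(1) zero_le)
  have "0 < N" using ij by simp
  then obtain M where M: "M < N" "\<And>k. k < N \<Longrightarrow> u k \<le> u M"
    using ex_maximizer_lessThan[of N u] by blast
  obtain m where m: "m < N" "\<And>k. k < N \<Longrightarrow> u m \<le> u k"
    using ex_maximizer_lessThan[OF \<open>0 < N\<close>, of "\<lambda>k. - u k"] by auto
  have nn: "\<And>i k. i < N \<Longrightarrow> k < N \<Longrightarrow> W $$ (i,k) \<ge> 0"
    using W by (auto simp: adjacency_matrix_def)
  have "c \<ge> 0" unfolding eq[OF M(1), symmetric]
    by (rule sum_nonneg) (use nn M in auto)
  have "c \<le> 0" unfolding eq[OF m(1), symmetric]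
    by (rule sum_nonpos) (use nn m in \<open>auto intro!: mult_nonneg_nonpos\<close>)
  have "u r = u M"
    by (rule maximum_attained_at_root[OF G(1) r(2)[OF M(1)] W eq \<open>c \<le> 0\<close> M(2)])
  moreover have "- u r = - u m"
  proof (rule maximum_attained_at_root[OF G(1) r(2)[OF m(1)] W, of "\<lambda>k. - u k" "- c"])
    fix i assume "i < N"
    have "(\<Sum>k\<in>{0..<N} - {i}. W $$ (i, k) * (- u i - - u k))
        = (\<Sum>k\<in>{0..<N} - {i}. - (W $$ (i, k) * (u i - u k)))"
      by (rule sum.cong) (auto simp: algebra_simps)
    also have "\<dots> = - c" unfolding sum_negf eq[OF \<open>i < N\<close>] ..
    finally show "(\<Sum>k\<in>{0..<N} - {i}. W $$ (i, k) * (- u i - - u k)) = - c" .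
  qed (use \<open>c \<ge> 0\<close> m in auto)
  ultimately show ?thesis using M(2)[OF ij(1)] M(2)[OF ij(2)] m(2)[OF ij(1)] m(2)[OF ij(2)] by simp
qed

lemma laplacian_row_action:
  fixes v :: "nat \<Rightarrow> complex"
  assumes "W \<in> carrier_mat N N" "i < N"
  shows "(\<Sum>j<N. complex_of_real (laplacian_of N W $$ (i,j)) * v j)
     = (\<Sum>k\<in>{0..<N} - {i}. W $$ (i,k) * (v i - v k))"
proof -
  have "(\<Sum>j<N. complex_of_real (laplacian_of N W $$ (i,j)) * v j)
    = (\<Sum>j\<in>insert i ({0..<N} - {i}). complex_of_real (laplacian_of N W $$ (i,j)) * v j)"
    by (rule sum.cong) (use assms in auto)
  also have "\<dots> = complex_of_real (laplacian_of N W $$ (i,i)) * v i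
      + (\<Sum>k\<in>{0..<N} - {i}. complex_of_real (laplacian_of N W $$ (i,k)) * v k)"
    by (subst sum.insert) auto
  also have "(\<Sum>k\<in>{0..<N} - {i}. complex_of_real (laplacian_of N W $$ (i,k)) * v k)
      = (\<Sum>k\<in>{0..<N} - {i}. - (W $$ (i,k) * v k))"
    by (rule sum.cong) (use assms in \<open>auto simp: laplacian_of_def\<close>)
  also have "complex_of_real (laplacian_of N W $$ (i,i)) = (\<Sum>k\<in>{0..<N} - {i}. W $$ (i,k))"
    using assms by (simp add: laplacian_of_def)
  also have "(\<Sum>k\<in>{0..<N} - {i}. W $$ (i,k)) * v i + (\<Sum>k\<in>{0..<N} - {i}. - (W $$ (i,k) * v k))
      = (\<Sum>k\<in>{0..<N} - {i}. W $$ (i,k) * (v i - v k))"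
    by (simp add: algebra_simps sum_subtractf sum_distrib_left sum_negf)
  finally show ?thesis .
qed

lemma laplacian_row_sum:
  assumes "W \<in> carrier_mat N N" "i < N"
  shows "(\<Sum>j<N. laplacian_of N W $$ (i,j)) = 0"
  using laplacian_row_action[OF assms, of "\<lambda>_. 1"] by (simp flip: of_real_sum)

text \<open>
  With \<open>Q\<close> the map that subtracts component 0 from every component, this is the matrix
  \<open>M = Q L + 1 e\<^sup>T\<close>, where 1 is the all-ones vector and \<open>e\<close> the unit vector of index 0.
  Since \<open>L\<close> kills the constants, \<open>Q L = M Q\<close>, so \<open>M\<close> governs the differences to component 0.
  The rank one term does not change the action on the image of \<open>Q\<close>; it moves the spurious
  eigenvalue 0 with left eigenvector \<open>e\<close> to 1. This avoids working with matrices of size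
  \<open>N - 1\<close>.
\<close>

definition difference_laplacian :: "nat \<Rightarrow> real mat \<Rightarrow> complex mat" where
  "difference_laplacian N L = mat N N (\<lambda>(i, j).
     complex_of_real (L $$ (i,j) - L $$ (0,j)) + (if j = 0 then 1 else 0))"

lemma difference_laplacian_action:
  assumes "i < N"
  shows "(\<Sum>j<N. difference_laplacian N L $$ (i,j) * v j) =
    (\<Sum>j<N. complex_of_real (L $$ (i,j)) * v j) - (\<Sum>j<N. complex_of_real (L $$ (0,j)) * v j) + v 0"
proof -
  have "(\<Sum>j<N. difference_laplacian N L $$ (i,j) * v j) =
     (\<Sum>j<N. (complex_of_real (L $$ (i,j)) * v j - complex_of_real (L $$ (0,j)) * v j) + (if j = 0 then v j else 0))"
    by (rule sum.cong) (use assms in \<open>auto simp: difference_laplacian_def algebra_simps\<close>)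
  also have "\<dots> = (\<Sum>j<N. complex_of_real (L $$ (i,j)) * v j) - (\<Sum>j<N. complex_of_real (L $$ (0,j)) * v j) + v 0"
    using assms by (simp add: sum.distrib sum_subtractf sum.delta)
  finally show ?thesis .
qed

text \<open>
  An eigenvector with nonzero component 0 has eigenvalue 1. Otherwise it satisfies
  \<open>L v = \<mu> v + c 1\<close> for some constant \<open>c\<close>: it is an eigenvector of \<open>L\<close> modulo the constants,
  and this quotient has lost the eigenvalue 0.
\<close>

lemma difference_laplacian_eigenvalue:
  assumes G: "graph_on N G" "contains_connected_spanning_tree G"
    and L: "weighted_laplacian N G L"
    and ev: "eigenvalue (difference_laplacian N L) \<mu>"
  shows "Re \<mu> > 0"
proof -
  let ?M = "difference_laplacian N L"
  obtain W where W: "adjacency_matrix N G W" and LW: "L = laplacian_of N W"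
    using L unfolding weighted_laplacian_def by blast
  have Wc: "W \<in> carrier_mat N N" and nn: "\<And>i j. i < N \<Longrightarrow> j < N \<Longrightarrow> W $$ (i,j) \<ge> 0"
    using W by (auto simp: adjacency_matrix_def)
  have M: "?M \<in> carrier_mat N N" by (simp add: difference_laplacian_def)
  obtain x where x: "x \<in> carrier_vec N" "x \<noteq> 0\<^sub>v N" "?M *\<^sub>v x = \<mu> \<cdot>\<^sub>v x"
    using ev M unfolding eigenvalue_def eigenvector_def by auto
  define v where "v j = x $ j" for j
  have nz: "\<exists>i<N. v i \<noteq> 0" using x by (auto simp: v_def vec_eq_iff)
  let ?\<Lambda> = "\<lambda>(u :: nat \<Rightarrow> complex) i. \<Sum>k\<in>{0..<N} - {i}. W $$ (i,k) * (u i - u k)"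
  have N: "0 < N" using nz by auto
  have eq: "?\<Lambda> v i - ?\<Lambda> v 0 + v 0 = \<mu> * v i" if "i < N" for i
  proof -
    have "\<mu> * v i = (?M *\<^sub>v x) $ i" using x that by (simp add: v_def)
    also have "\<dots> = (\<Sum>j<N. ?M $$ (i,j) * v j)"
      using M x(1) that by (auto simp: scalar_prod_def v_def lessThan_atLeast0 intro!: sum.cong)
    also have "\<dots> = ?\<Lambda> v i - ?\<Lambda> v 0 + v 0"
      unfolding difference_laplacian_action[OF that] LW laplacian_row_action[OF Wc that]
        laplacian_row_action[OF Wc N] ..
    finally show ?thesis ..
  qed
  show ?thesis
  proof (cases "v 0 = 0")
    case False
    then show ?thesis using eq[OF N] by simp
  next
    case v0: True
    define c where "c = ?\<Lambda> v 0"
    have eqc: "?\<Lambda> v i = \<mu> * v i + c" if "i < N" for i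
      using eq[OF that] v0 by (simp add: c_def algebra_simps)
    show ?thesis
    proof (cases "\<mu> = 0")
      case True
      have "Re (v i) = Re (v 0)" if "i < N" for i
      proof (rule laplacian_preimage_of_constant[OF G W _ that N])
        show "(\<Sum>k\<in>{0..<N} - {i}. W $$ (i, k) * (Re (v i) - Re (v k))) = Re c" if "i < N" for i
          using arg_cong[OF eqc[OF that], of Re] True by simp
      qed
      moreover have "Im (v i) = Im (v 0)" if "i < N" for i
      proof (rule laplacian_preimage_of_constant[OF G W _ that N])
        show "(\<Sum>k\<in>{0..<N} - {i}. W $$ (i, k) * (Im (v i) - Im (v k))) = Im c" if "i < N" for i
          using arg_cong[OF eqc[OF that], of Im] True by simp
      qed
      ultimately have "v i = 0" if "i < N" for i
        using that v0 by (simp add: complex_eq_iff)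
      with nz show ?thesis by blast
    next
      case False
      show ?thesis
      proof (rule laplacian_eigenvalue_Re_pos[of N "\<lambda>i j. W $$ (i,j)" "\<lambda>i. v i + c / \<mu>", OF nn _ False])
        \<comment> \<open>As \<open>L\<close> kills the constants, adding \<open>c / \<mu>\<close> turns \<open>v\<close> into a true eigenvector.\<close>
        show "?\<Lambda> (\<lambda>i. v i + c / \<mu>) i = \<mu> * (v i + c / \<mu>)" if "i < N" for i
          using eqc[OF that] False by (simp add: algebra_simps)
        show "\<exists>i<N. v i + c / \<mu> \<noteq> 0"
        proof (rule ccontr)
          assume *: "\<not> (\<exists>i<N. v i + c / \<mu> \<noteq> 0)"
          then have "c / \<mu> = 0" using N v0 by auto
          with * nz show False by auto
        qed
      qed
    qed
  qed
qed

section \<open>The serial closed loop\<close>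

lemma scalar_mat_mult_vec:
  fixes v :: "complex Matrix.vec"
  assumes "v \<in> carrier_vec N"
  shows "(c \<cdot>\<^sub>m 1\<^sub>m N) *\<^sub>v v = c \<cdot>\<^sub>v v"
proof (rule eq_vecI)
  fix i assume "i < dim_vec (c \<cdot>\<^sub>v v)"
  then have i: "i < N" using assms by simp
  have "((c \<cdot>\<^sub>m 1\<^sub>m N) *\<^sub>v v) $ i = (\<Sum>j\<in>{0..<N}. c * (if j = i then 1 else 0) * v $ j)"
    using assms i by (simp add: scalar_prod_def)
  also have "\<dots> = (\<Sum>j\<in>{0..<N}. if i = j then c * v $ j else 0)"
    by (rule sum.cong) auto
  also have "\<dots> = c * v $ i" using i by simp
  finally show "((c \<cdot>\<^sub>m 1\<^sub>m N) *\<^sub>v v) $ i = (c \<cdot>\<^sub>v v) $ i" using assms i by simp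
qed (use assms in simp)

text \<open>
  One factor of the closed loop: subtracting component 0 turns \<open>(s I + L) Z = V\<close> into
  \<open>(s I + M) Y = Q V\<close> with \<open>Y = Q Z\<close>, where the eigenvalues of \<open>M\<close> lie in the open right half
  plane.
\<close>

lemma laplacian_step_differences:
  assumes G: "graph_on N G" "contains_connected_spanning_tree G"
    and L: "weighted_laplacian N G L" and \<sigma>: "\<sigma> \<ge> 0"
    and Z: "\<And>s. Z s \<in> carrier_vec N"
    and eq: "\<And>s. Re s > \<sigma> \<Longrightarrow> (s \<cdot>\<^sub>m 1\<^sub>m N + map_mat complex_of_real L) *\<^sub>v Z s = V s"
    and V: "\<And>i. i < N \<Longrightarrow> stable_plus_poly \<sigma> (Suc d) (\<lambda>s. V s $ i - V s $ 0)"
    and i: "i < N"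
  shows "stable_plus_poly \<sigma> d (\<lambda>s. Z s $ i - Z s $ 0)"
proof (rule resolvent_stable[OF _ difference_laplacian_eigenvalue[OF G L] \<sigma> _ V i])
  show "difference_laplacian N L \<in> carrier_mat N N" by (simp add: difference_laplacian_def)
next
  fix s i assume s: "Re s > \<sigma>" and i: "i < N"
  obtain W where W: "adjacency_matrix N G W" and LW: "L = laplacian_of N W"
    using L unfolding weighted_laplacian_def by blast
  have Wc: "W \<in> carrier_mat N N" using W by (auto simp: adjacency_matrix_def)
  have Lc: "L \<in> carrier_mat N N" by (simp add: LW laplacian_of_def)
  have V: "V s $ i = s * Z s $ i + (\<Sum>j<N. complex_of_real (L $$ (i,j)) * Z s $ j)" if "i < N" for i
  proof -
    have "V s = (s \<cdot>\<^sub>m 1\<^sub>m N) *\<^sub>v Z s + map_mat complex_of_real L *\<^sub>v Z s"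
      unfolding eq[OF s, symmetric] using Lc Z by (intro add_mult_distrib_mat_vec) auto
    also have "(s \<cdot>\<^sub>m 1\<^sub>m N) *\<^sub>v Z s = s \<cdot>\<^sub>v Z s"
      using Z[of s] by (simp add: scalar_mat_mult_vec)
    finally show ?thesis
      using Lc Z[of s] that by (auto simp: scalar_prod_def lessThan_atLeast0 intro!: sum.cong)
  qed
  have rs: "(\<Sum>j<N. complex_of_real (L $$ (i,j)) * (Z s $ j - Z s $ 0)) = (\<Sum>j<N. complex_of_real (L $$ (i,j)) * Z s $ j)"
    if "i < N" for i
    using laplacian_row_sum[OF Wc that]
    by (simp add: LW right_diff_distrib sum_subtractf flip: sum_distrib_right of_real_sum)
  have "0 < N" using i by simp
  then show "s * (Z s $ i - Z s $ 0) + (\<Sum>j<N. difference_laplacian N L $$ (i, j) * (Z s $ j - Z s $ 0)) = V s $ i - V s $ 0"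
    unfolding difference_laplacian_action[OF i] rs[OF i] rs[OF \<open>0 < N\<close>] V[OF i] V[OF \<open>0 < N\<close>]
    by (simp add: algebra_simps)
qed

lemma serial_foldr_carrier:
  assumes "\<And>k. k \<in> set ks \<Longrightarrow> L k \<in> carrier_mat N N"
  shows "foldr (\<lambda>k M. (s \<cdot>\<^sub>m 1\<^sub>m N + map_mat complex_of_real (L k)) * M) ks (1\<^sub>m N) \<in> carrier_mat N N"
  using assms
proof (induction ks)
  case (Cons k ks)
  then show ?case
    by (auto intro!: mult_carrier_mat[of _ N N])
qed simp

lemma weighted_laplacian_carrier: "weighted_laplacian N G L \<Longrightarrow> L \<in> carrier_mat N N"
  by (auto simp: weighted_laplacian_def laplacian_of_def)

text \<open>
  The factors are inverted one after the other, the leftmost first. They need not commute and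
  need not have common eigenvectors; they only share the invariant constants, which the differences
  ignore.
\<close>

lemma serial_product_differences:
  assumes G: "graph_on N G" "contains_connected_spanning_tree G" and \<sigma>: "\<sigma> \<ge> 0"
    and L: "\<And>k. k \<in> set ks \<Longrightarrow> weighted_laplacian N G (L k)"
    and X: "\<And>s. X s \<in> carrier_vec N"
    and eq: "\<And>s. Re s > \<sigma> \<Longrightarrow>
      foldr (\<lambda>k M. (s \<cdot>\<^sub>m 1\<^sub>m N + map_mat complex_of_real (L k)) * M) ks (1\<^sub>m N) *\<^sub>v X s = V s"
    and V: "\<And>i. i < N \<Longrightarrow> stable_plus_poly \<sigma> (d + length ks) (\<lambda>s. V s $ i - V s $ 0)"
    and i: "i < N"
  shows "stable_plus_poly \<sigma> d (\<lambda>s. X s $ i - X s $ 0)"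
  using L eq V i
proof (induction ks arbitrary: V i)
  case Nil
  from Nil(3)[OF Nil(4)] have "stable_plus_poly \<sigma> d (\<lambda>s. V s $ i - V s $ 0)" by simp
  then show ?case by (rule stable_plus_poly_cong) (use Nil(2) X in simp)
next
  case (Cons k ks)
  let ?F = "\<lambda>s. foldr (\<lambda>k M. (s \<cdot>\<^sub>m 1\<^sub>m N + map_mat complex_of_real (L k)) * M) ks (1\<^sub>m N)"
  have Lc: "L k' \<in> carrier_mat N N" if "k' \<in> set (k # ks)" for k'
    using Cons(2)[OF that] by (rule weighted_laplacian_carrier)
  have F: "?F s \<in> carrier_mat N N" for s by (rule serial_foldr_carrier) (use Lc in auto)
  show ?case
  proof (rule Cons.IH[of "\<lambda>s. ?F s *\<^sub>v X s", OF _ _ _ Cons(5)])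
    fix i assume i: "i < N"
    show "stable_plus_poly \<sigma> (d + length ks) (\<lambda>s. (?F s *\<^sub>v X s) $ i - (?F s *\<^sub>v X s) $ 0)"
    proof (rule laplacian_step_differences[OF G _ \<sigma> _ _ _ i])
      show "weighted_laplacian N G (L k)" using Cons(2) by simp
      show "?F s *\<^sub>v X s \<in> carrier_vec N" for s by (rule mult_mat_vec_carrier[OF F X])
      show "(s \<cdot>\<^sub>m 1\<^sub>m N + map_mat complex_of_real (L k)) *\<^sub>v (?F s *\<^sub>v X s) = V s" if "Re s > \<sigma>" for s
        unfolding Cons(3)[OF that, symmetric] foldr_Cons o_apply
        by (rule assoc_mult_mat_vec[OF _ F X, symmetric]) (use Lc[of k] in auto)
      show "stable_plus_poly \<sigma> (Suc (d + length ks)) (\<lambda>s. V s $ i - V s $ 0)" if "i < N" for i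
        using Cons(4)[OF that] by simp
    qed
  qed (use Cons(2) in auto)
qed

text \<open>
  Initial values enter the closed loop through polynomials of degree less than \<open>n\<close> and the
  reference through a proper function, so the \<open>n\<close> resolvents leave a strictly proper stable
  function for every difference.
\<close>

lemma serial_controller_achieves_consensus:
  assumes n: "n \<ge> 1" and G: "graph_on N G" "contains_connected_spanning_tree G"
    and L: "\<And>k. k \<in> {1..n} \<Longrightarrow> weighted_laplacian N G (L k)"
    and U: "Uref \<in> RH_inf_vec N"
  shows "achieves_consensus n G (serial_controller n N L Uref)"
proof -
  have verts: "pverts G = {0..<N}" using G(1) by (simp add: graph_on_def)
  have "((\<lambda>t. \<bar>(deriv ^^ k) (x i) t - (deriv ^^ k) (x j) t\<bar>) \<longlongrightarrow> 0) at_top"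
    if cl: "closed_loop_trajectory n N (serial_controller n N L Uref) x0 x" and "i < N" "j < N" and k: "k < n"
    for x0 x i j k
  proof -
    have diff: "(deriv ^^ k) (x i) field_differentiable at t" if "i < N" "k < n" "t > 0" for i k t
      using cl that unfolding closed_loop_trajectory_def by blast
    obtain \<sigma>' where loop: "\<And>s i. Re s > \<sigma>' \<Longrightarrow> i < N \<Longrightarrow> laplace_converges (x i) s"
      "\<And>s. Re s > \<sigma>' \<Longrightarrow> integrator_system n N x0 s (laplace_vec N x s) (serial_controller n N L Uref s (laplace_vec N x s))"
      using cl unfolding closed_loop_trajectory_def by blast
    \<comment> \<open>The modes are described by their transforms on the half plane \<open>Re s \<ge> 0\<close> only.\<close>
    define \<sigma> where "\<sigma> = max 0 \<sigma>'"
    have \<sigma>: "\<sigma> \<ge> 0" "\<sigma> \<ge> \<sigma>'" by (simp_all add: \<sigma>_def)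
    let ?X = "laplace_vec N x"
    define I where "I s = Matrix.vec N (\<lambda>i. \<Sum>k<n. s ^ (n - 1 - k) * complex_of_real (x0 k i))" for s
    have X: "?X s \<in> carrier_vec N" for s by (simp add: laplace_vec_def)
    have Uc: "Uref s \<in> carrier_vec N" for s using U by (simp add: RH_inf_vec_def)
    have Ic: "I s \<in> carrier_vec N" for s by (simp add: I_def)
    have P: "serial_product n N L s \<in> carrier_mat N N" for s
      unfolding serial_product_def
      by (rule serial_foldr_carrier) (rule weighted_laplacian_carrier, rule L, use n in auto)
    have loop_eq: "serial_product n N L s *\<^sub>v ?X s = Uref s + I s" if "Re s > \<sigma>" for s
    proof -
      have "(s ^ n \<cdot>\<^sub>m 1\<^sub>m N - serial_product n N L s) *\<^sub>v ?X s = s ^ n \<cdot>\<^sub>v ?X s - serial_product n N L s *\<^sub>v ?X s"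
        using P[of s] X[of s] by (subst minus_mult_distrib_mat_vec) (auto simp: scalar_mat_mult_vec)
      then have e: "s ^ n \<cdot>\<^sub>v ?X s - I s = Uref s + (s ^ n \<cdot>\<^sub>v ?X s - serial_product n N L s *\<^sub>v ?X s)"
        using loop(2)[of s] that \<sigma> by (simp add: integrator_system_def serial_controller_def I_def)
      show ?thesis
      proof (rule eq_vecI)
        fix i assume "i < dim_vec (Uref s + I s)"
        then have i: "i < N" using Ic[of s] by simp
        show "(serial_product n N L s *\<^sub>v ?X s) $ i = (Uref s + I s) $ i"
          using arg_cong[OF e, of "\<lambda>v. v $ i"] i X[of s] carrier_matD(1)[OF P] Uc[of s] Ic[of s]
          by (simp add: algebra_simps del: index_mult_mat_vec)
      qed (use carrier_matD(1)[OF P] Ic[of s] in simp)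
    qed
    have V: "stable_plus_poly \<sigma> n (\<lambda>s. (Uref s + I s) $ i)" if i: "i < N" for i
    proof (rule stable_plus_poly_cong)
      have u: "stable_plus_poly \<sigma> n (\<lambda>s. Uref s $ i)"
        using U i n unfolding RH_inf_vec_def
        by (intro stable_plus_poly_mono[OF RH_inf_stable_plus_poly_1[OF _ \<sigma>(1)]]) auto
      have x: "stable_plus_poly \<sigma> n (\<lambda>s. \<Sum>k<n. poly (Polynomial.monom (complex_of_real (x0 k i)) (n - 1 - k)) s)"
        by (intro stable_plus_poly_sum stable_plus_poly_poly) auto
      show "stable_plus_poly \<sigma> n (\<lambda>s. Uref s $ i +
          (\<Sum>k<n. poly (Polynomial.monom (complex_of_real (x0 k i)) (n - 1 - k)) s))"
        by (rule stable_plus_poly_add[OF u x])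
    next
      fix s show "(Uref s + I s) $ i = Uref s $ i +
          (\<Sum>k<n. poly (Polynomial.monom (complex_of_real (x0 k i)) (n - 1 - k)) s)"
        using i Ic[of s] by (simp add: I_def poly_monom mult.commute)
    qed
    have to_0: "((\<lambda>t. (deriv ^^ k) (x i) t - (deriv ^^ k) (x 0) t) \<longlongrightarrow> 0) at_top" if i: "i < N" for i
    proof -
      have N: "0 < N" using i by simp
      have "stable_plus_poly \<sigma> 0 (\<lambda>s. ?X s $ i - ?X s $ 0)"
      proof (rule serial_product_differences[where ks = "[1..<Suc n]" and L = L and V = "\<lambda>s. Uref s + I s",
            OF G \<sigma>(1) _ X _ _ i])
        show "stable_plus_poly \<sigma> (0 + length [1..<Suc n]) (\<lambda>s. (Uref s + I s) $ i - (Uref s + I s) $ 0)"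
          if "i < N" for i
          using stable_plus_poly_diff[OF V[OF that] V[OF N]] by (simp del: upt_Suc)
      qed (use L loop_eq in \<open>auto simp: serial_product_def\<close>)
      then obtain K where K: "stable_transfer K"
        and eqK: "\<And>s. Re s > \<sigma> \<Longrightarrow> ?X s $ i - ?X s $ 0 = K s"
        unfolding stable_plus_poly_0_iff by blast
      have conv: "laplace_converges (x j) s" if "Re s = \<sigma> + 1" "j < N" for j s
        using loop(1)[of s j] that \<sigma> by auto
      have "\<exists>g G. stable_mode_sum g G \<and> (\<forall>t>0. x i t - x 0 t = Re (g t))"
      proof (rule eq_stable_modes_if_laplace_stable[OF K, of "\<sigma> + 1"])
        show "laplace_converges (\<lambda>t. x i t - x 0 t) s" if "Re s = \<sigma> + 1" for s
          by (rule laplace_diff(1)[OF conv[OF that i] conv[OF that N]])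
        show "laplace (\<lambda>t. x i t - x 0 t) s = K s" if "Re s = \<sigma> + 1" for s
          using laplace_diff(2)[OF conv[OF that i] conv[OF that N]] eqK[of s] that i N
          by (simp add: laplace_vec_def)
        show "isCont (\<lambda>t. x i t - x 0 t) t" if "t > 0" for t
          using diff[OF i _ that, of 0] diff[OF N _ that, of 0] n
          by (intro continuous_diff field_differentiable_imp_continuous_at) auto
      qed (use \<sigma> in simp)
      then obtain g G where "stable_mode_sum g G" "\<And>t. t > 0 \<Longrightarrow> x i t - x 0 t = Re (g t)" by blast
      from iterated_derivative_difference[OF diff[OF i] diff[OF N] this k]
      obtain g G where g: "stable_mode_sum g G"
        and eq: "\<forall>t>0. (deriv ^^ k) (x i) t - (deriv ^^ k) (x 0) t = Re (g t)" by blast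
      have "((\<lambda>t. Re (g t)) \<longlongrightarrow> 0) at_top"
        using tendsto_Re[OF stable_mode_sum_tendsto_0[OF g]] by simp
      moreover have "\<forall>\<^sub>F t in at_top. Re (g t) = (deriv ^^ k) (x i) t - (deriv ^^ k) (x 0) t"
        using eventually_gt_at_top[of 0] by eventually_elim (use eq in auto)
      ultimately show ?thesis by (rule Lim_transform_eventually)
    qed
    from tendsto_diff[OF to_0[OF \<open>i < N\<close>] to_0[OF \<open>j < N\<close>]] show ?thesis
      by (intro tendsto_rabs_zero) simp
  qed
  then show ?thesis unfolding achieves_consensus_def verts by simp
qed

theorem corollary5:
  fixes n :: nat
    and \<N> :: "nat set"
    and \<G> :: "nat \<Rightarrow> nat pair_pre_digraph"
    and L :: "nat \<Rightarrow> nat \<Rightarrow> real mat"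
    and Uref :: "nat \<Rightarrow> complex \<Rightarrow> complex Matrix.vec"
  assumes "n \<ge> 1"
    and "\<And>N. N \<in> \<N> \<Longrightarrow> graph_on N (\<G> N)"
    and "\<And>N. N \<in> \<N> \<Longrightarrow> contains_connected_spanning_tree (\<G> N)"
    and "\<And>N k. N \<in> \<N> \<Longrightarrow> k \<in> {1..n} \<Longrightarrow> weighted_laplacian N (\<G> N) (L N k)"
    and "\<And>N. N \<in> \<N> \<Longrightarrow> Uref N \<in> RH_inf_vec N"
  shows "scalably_stable n \<N> \<G> (\<lambda>N. serial_controller n N (L N) (Uref N))"
  unfolding scalably_stable_def
proof
  fix N assume N: "N \<in> \<N>"
  show "achieves_consensus n (\<G> N) (serial_controller n N (L N) (Uref N))"
    by (rule serial_controller_achieves_consensus[OF assms(1) assms(2,3)[OF N] assms(4)[OF N] assms(5)[OF N]])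
qed

end
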